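(* Let $n,k,p\ge 1$ be integers with $k+p\le n$. Let $X_1$ and $X_2$ be respectively $(n-k)\times k$ and $(n-k)\times p$ random matrices with i.i.d. $\mathcal{N}(0,1)$ entries, let $\Sigma$ be a $k\times k$ diagonal random matrix whose diagonal entries are the singular values of a $(k+p)\times k$ matrix with i.i.d. $\mathcal{N}(0,1)$ entries, with $X_1,X_2,\Sigma$ independent, and define $$W = \bigl\| f(I_{n-k},X_2)\,\begin{bmatrix} X_1\Sigma^{-1} & I_{n-k}\end{bmatrix} \bigr\|.$$ Then $$\sqrt{n-(k+p+2)}\;\mathbb{E}\,\|\Sigma^{-1}\| \;\le\; \mathbb{E}\,W \;\le\; 1+\bigl(\sqrt{n-k}+\sqrt{k}\bigr)\,\mathbb{E}\,\|\Sigma^{-1}\|,$$ where the lower bound is asserted when $n\ge k+p+2$.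
   Context: For a real $r\times s$ matrix $A$ and a real matrix $G$ with $s$ rows, $f(A,G) := (I-QQ^* )A$, where the columns of $Q$ form an orthonormal basis of the range of $AG$; that is, $QQ^*$ is the orthogonal projector onto the range of $AG$. In particular $f(I_{n-k},X_2)$ is the orthogonal projector onto the orthogonal complement of the range of $X_2$. $\|\cdot\|$ is the spectral norm and $I_r$ is the $r\times r$ identity matrix. *)

theory Defs
  imports "HOL-Analysis.Analysis" "HOL-Probability.Probability"
begin

text \<open>An \<open>r \<times> s\<close> real matrix has type \<open>real^'s^'r\<close>: the column index type comes first.\<close>

definition spectral_norm :: "real^'s^'r \<Rightarrow> real" where
  "spectral_norm A = onorm (\<lambda>x. A *v x)"

definition hcat :: "real^'a^'r \<Rightarrow> real^'b^'r \<Rightarrow> real^('a + 'b)^'r" where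
  "hcat A B = (\<chi> i j. case j of Inl a \<Rightarrow> A $ i $ a | Inr b \<Rightarrow> B $ i $ b)"

definition is_diagonal :: "real^'k^'k \<Rightarrow> bool" where
  "is_diagonal D \<longleftrightarrow> (\<forall>i j. i \<noteq> j \<longrightarrow> D $ i $ j = 0)"

definition orthonormal_basis :: "'a::euclidean_space set \<Rightarrow> 'a set \<Rightarrow> bool" where
  "orthonormal_basis B S \<longleftrightarrow> pairwise orthogonal B \<and> (\<forall>q\<in>B. norm q = 1) \<and> span B = S"

text \<open>If \<open>B\<close> is the set of columns of a matrix \<open>Q\<close> with orthonormal columns, this is
  \<open>Q Q\<^sup>*\<close>, written as the sum of the rank-one matrices \<open>q q\<^sup>*\<close>. A set of columns is used
  because the number of columns of \<open>Q\<close> is the rank of a matrix and so cannot be a type.\<close>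

definition QQ_star :: "(real^'r) set \<Rightarrow> real^'r^'r" where
  "QQ_star B = (\<Sum>q\<in>B. \<chi> i j. q $ i * q $ j)"

text \<open>The matrix \<open>f(A,G) = (I - Q Q\<^sup>*) A\<close>. By \<open>QQ_star_unique\<close> below it does not depend on
  the chosen basis.\<close>

definition residual :: "real^'s^'r \<Rightarrow> real^'t^'s \<Rightarrow> real^'s^'r" where
  "residual A G =
     (mat 1 - QQ_star (SOME B. orthonormal_basis B (range (\<lambda>x. (A ** G) *v x)))) ** A"

lemma orthonormal_basis_exists:
  assumes "subspace S"
  shows "\<exists>B. orthonormal_basis B S"
  using orthonormal_basis_subspace[OF assms] unfolding orthonormal_basis_def by metis

lemma orthonormal_basis_finite:
  assumes "orthonormal_basis B S"
  shows "finite B"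
  using assms pairwise_orthogonal_imp_finite unfolding orthonormal_basis_def by blast

lemma QQ_star_mult:
  assumes "finite B"
  shows "QQ_star B *v x = (\<Sum>q\<in>B. (q \<bullet> x) *\<^sub>R q)"
proof -
  have "(QQ_star B *v x) $ i = (\<Sum>q\<in>B. (q \<bullet> x) *\<^sub>R q) $ i" for i
  proof -
    have "(QQ_star B *v x) $ i = (\<Sum>j\<in>UNIV. \<Sum>q\<in>B. q $ i * q $ j * x $ j)"
      by (simp add: QQ_star_def matrix_vector_mult_def sum_distrib_right)
    also have "\<dots> = (\<Sum>q\<in>B. \<Sum>j\<in>UNIV. q $ i * q $ j * x $ j)"
      by (rule sum.swap)
    also have "\<dots> = (\<Sum>q\<in>B. (q \<bullet> x) *\<^sub>R q) $ i"
      by (simp add: inner_vec_def sum_distrib_left sum_distrib_right algebra_simps)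
    finally show ?thesis .
  qed
  then show ?thesis by (simp add: vec_eq_iff)
qed

text \<open>\<open>Q Q\<^sup>*\<close> is the orthogonal projector onto the space spanned by the columns of \<open>Q\<close>.\<close>

lemma QQ_star_projects:
  assumes B: "orthonormal_basis B S"
  shows "QQ_star B *v x \<in> S" and "y \<in> S \<Longrightarrow> (x - QQ_star B *v x) \<bullet> y = 0"
proof -
  note fin = orthonormal_basis_finite[OF B]
  from B have S: "S = span B" by (simp add: orthonormal_basis_def)
  show "QQ_star B *v x \<in> S"
    unfolding QQ_star_mult[OF fin] S by (intro span_sum span_mul span_base)
  have q0: "q \<bullet> (x - QQ_star B *v x) = 0" if "q \<in> B" for q
  proof -
    have "(\<Sum>r\<in>B. (r \<bullet> x) * (q \<bullet> r)) = (\<Sum>r\<in>B. if r = q then q \<bullet> x else 0)"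
    proof (rule sum.cong[OF refl])
      fix r assume "r \<in> B"
      with B that show "(r \<bullet> x) * (q \<bullet> r) = (if r = q then q \<bullet> x else 0)"
        by (auto simp: orthonormal_basis_def pairwise_def orthogonal_def norm_eq_1)
    qed
    then show ?thesis
      using that fin by (simp add: QQ_star_mult inner_diff_right inner_sum_right)
  qed
  show "(x - QQ_star B *v x) \<bullet> y = 0" if "y \<in> S"
    using orthogonal_to_span[of y B "x - QQ_star B *v x"] that q0
    by (auto simp: S orthogonal_def inner_commute)
qed

lemma QQ_star_unique:
  assumes B: "orthonormal_basis B S" and C: "orthonormal_basis C S"
  shows "QQ_star B = QQ_star C"
proof -
  have "QQ_star B *v x = QQ_star C *v x" for x
  proof -
    let ?d = "QQ_star B *v x - QQ_star C *v x"
    have "subspace S" using B by (auto simp: orthonormal_basis_def)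
    then have d: "?d \<in> S"
      using QQ_star_projects(1)[OF B] QQ_star_projects(1)[OF C] by (simp add: subspace_diff)
    have "?d \<bullet> ?d = (x - QQ_star C *v x) \<bullet> ?d - (x - QQ_star B *v x) \<bullet> ?d"
      by (simp add: inner_diff_left)
    also have "\<dots> = 0"
      using QQ_star_projects(2)[OF B d] QQ_star_projects(2)[OF C d] by simp
    finally show ?thesis by simp
  qed
  then show ?thesis by (simp add: matrix_eq)
qed

text \<open>Singular values of a matrix with at least as many rows as columns: the nonnegative square
  roots of the eigenvalues of \<open>A\<^sup>* A\<close>, counted with multiplicity. As \<open>A\<^sup>* A\<close> is symmetric, the
  multiplicity of an eigenvalue is the dimension of its eigenspace.\<close>

definition singular_value_multiplicity :: "real^'k^'r \<Rightarrow> real \<Rightarrow> nat" where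
  "singular_value_multiplicity A s =
     (if s \<ge> 0 then dim {x. (transpose A ** A) *v x = s\<^sup>2 *\<^sub>R x} else 0)"

text \<open>The family \<open>d\<close>, in whatever order, lists the singular values of \<open>A\<close>, each one as often as
  its multiplicity.\<close>

definition lists_singular_values :: "('k \<Rightarrow> real) \<Rightarrow> real^'k^'r \<Rightarrow> bool" where
  "lists_singular_values d A \<longleftrightarrow>
     (\<forall>s. card {j. d j = s} = singular_value_multiplicity A s)"

definition std_gaussian_matrix :: "'a measure \<Rightarrow> ('a \<Rightarrow> real^'s^'r) \<Rightarrow> bool" where
  "std_gaussian_matrix M X \<longleftrightarrow>
     prob_space.indep_vars M (\<lambda>_. borel) (\<lambda>(i, j) \<omega>. X \<omega> $ i $ j) UNIV \<and>
     (\<forall>i j. distributed M lborel (\<lambda>\<omega>. X \<omega> $ i $ j) std_normal_density)"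

text \<open>Mutual independence of three random variables. The library constant \<open>indep_vars\<close> needs a
  common value type, so the generated families of events are used directly, as in its
  definition.\<close>

definition indep_vars3 ::
  "'a measure \<Rightarrow> ('a \<Rightarrow> 'b::topological_space) \<Rightarrow> ('a \<Rightarrow> 'c::topological_space) \<Rightarrow>
    ('a \<Rightarrow> 'd::topological_space) \<Rightarrow> bool" where
  "indep_vars3 M X Y Z \<longleftrightarrow>
     X \<in> borel_measurable M \<and> Y \<in> borel_measurable M \<and> Z \<in> borel_measurable M \<and>
     prob_space.indep_sets M
       (\<lambda>i. [{X -` A \<inter> space M | A. A \<in> sets borel},
             {Y -` A \<inter> space M | A. A \<in> sets borel},
             {Z -` A \<inter> space M | A. A \<in> sets borel}] ! i) {0, 1, 2 :: nat}"

text \<open>Expectation of a nonnegative random variable, with values in \<open>[0, \<infinity>]\<close>.\<close>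

definition expect_nonneg :: "'a measure \<Rightarrow> ('a \<Rightarrow> real) \<Rightarrow> ennreal" where
  "expect_nonneg M X = (\<integral>\<^sup>+ \<omega>. ennreal (X \<omega>) \<partial>M)"

end

theory Submission
  imports Defs
begin

text \<open>Let \<open>P\<close> project onto the orthogonal complement of the range of \<open>X2\<close> and let \<open>R = S\<^sup>-\<^sup>1\<close>. Since
  \<open>P\<close> is a contraction, \<open>W \<le> 1 + \<parallel>X1\<parallel> \<parallel>R\<parallel>\<close>, and by independence the upper bound reduces to Chevet's
  inequality \<open>E \<parallel>X1\<parallel> \<le> sqrt (n - k) + sqrt k\<close>. This is the Sudakov--Fernique comparison of the
  processes \<open>v \<bullet> X1 u\<close> and \<open>u \<bullet> g + v \<bullet> h\<close> on pairs of unit vectors. The comparison is proved for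
  log-sum-exp, a smooth maximum, by writing both Gaussian families as normalised sums of
  \<open>N\<close> independent copies and exchanging the copies one at a time, as in Lindeberg's proof of the
  central limit theorem; the Taylor expansion of log-sum-exp involves the second moments only through
  those of the increments.

  For the lower bound, \<open>W \<ge> norm (P X1 R u)\<close> for unit \<open>u\<close>. Given \<open>X2\<close> and \<open>S\<close>, the vector
  \<open>X1 R u\<close> is Gaussian and \<open>P\<close> keeps at least \<open>d = n - k - p\<close> of its orthonormal coordinates, and the
  mean norm of a standard Gaussian vector in dimension \<open>d\<close> is at least
  \<open>d / sqrt (d + 2) \<ge> sqrt (d - 2)\<close> by its second and fourth moments.\<close>

section \<open>Linear forms in independent standard normal variables\<close>

definition std_normals :: "'a measure \<Rightarrow> ('i \<Rightarrow> 'a \<Rightarrow> real) \<Rightarrow> 'i set \<Rightarrow> bool" where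
  "std_normals M Z I \<longleftrightarrow> prob_space M \<and> prob_space.indep_vars M (\<lambda>_. borel) Z I \<and>
     (\<forall>i\<in>I. distributed M lborel (Z i) std_normal_density)"

lemma std_normals_subset:
  assumes "std_normals M Z I" "J \<subseteq> I"
  shows "std_normals M Z J"
  using assms prob_space.indep_vars_subset[of M "\<lambda>_. borel" Z I J]
  unfolding std_normals_def by blast

lemma std_normals_measurable:
  assumes "std_normals M Z I" "i \<in> I"
  shows "Z i \<in> borel_measurable M"
  using assms distributed_measurable[of M lborel "Z i"] unfolding std_normals_def by fastforce

text \<open>Sums of independent normal variables are normal as long as every standard deviation is
  positive, so the terms with coefficient zero are discarded first. The hypothesis \<open>nz\<close>
  keeps the remaining index set nonempty and the resulting deviation positive.\<close>

lemma std_normals_linear_form: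
  assumes Z: "std_normals M Z I" and I: "finite I" and nz: "\<exists>i\<in>I. c i \<noteq> 0"
  shows "distributed M lborel (\<lambda>\<omega>. \<Sum>i\<in>I. c i * Z i \<omega>) (normal_density 0 (sqrt (\<Sum>i\<in>I. (c i)\<^sup>2)))"
proof -
  interpret prob_space M using Z by (simp add: std_normals_def)
  define J where "J = {i\<in>I. c i \<noteq> 0}"
  have J: "finite J" "J \<noteq> {}" "J \<subseteq> I" using I nz by (auto simp: J_def)
  have ZJ: "std_normals M Z J" by (rule std_normals_subset[OF Z J(3)])
  have indep: "indep_vars (\<lambda>_. borel) (\<lambda>i \<omega>. c i * Z i \<omega>) J"
    using ZJ by (intro indep_vars_compose2[where Y="\<lambda>i x. c i * x"]) (auto simp: std_normals_def)
  have d: "distributed M lborel (\<lambda>\<omega>. c i * Z i \<omega>) (normal_density 0 \<bar>c i\<bar>)" if "i \<in> J" for i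
    using normal_density_affine[of "Z i" 0 1 "c i" 0] that ZJ
    by (auto simp: J_def std_normals_def)
  have "distributed M lborel (\<lambda>\<omega>. \<Sum>i\<in>J. c i * Z i \<omega>)
      (normal_density (\<Sum>i\<in>J. 0) (sqrt (\<Sum>i\<in>J. \<bar>c i\<bar>\<^sup>2)))"
    by (rule sum_indep_normal[OF J(1,2) indep _ d]) (auto simp: J_def)
  moreover have "(\<Sum>i\<in>J. c i * Z i \<omega>) = (\<Sum>i\<in>I. c i * Z i \<omega>)" for \<omega>
    using I by (intro sum.mono_neutral_left) (auto simp: J_def)
  moreover have "(\<Sum>i\<in>J. (c i)\<^sup>2) = (\<Sum>i\<in>I. (c i)\<^sup>2)"
    using I by (intro sum.mono_neutral_left) (auto simp: J_def)
  ultimately show ?thesis by simp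
qed

text \<open>The zero form has no density and is treated apart. Any other form is centred normal with
  variance \<open>\<sigma>\<^sup>2\<close>, and its moments are those of the normal density.\<close>

lemma std_normals_linear_form_moments:
  fixes c :: "'i \<Rightarrow> real"
  assumes Z: "std_normals M Z I" and I: "finite I"
  defines "L \<equiv> \<lambda>\<omega>. \<Sum>i\<in>I. c i * Z i \<omega>"
  shows "has_bochner_integral M L 0"
    and "has_bochner_integral M (\<lambda>\<omega>. (L \<omega>)\<^sup>2) (\<Sum>i\<in>I. (c i)\<^sup>2)"
    and "has_bochner_integral M (\<lambda>\<omega>. (L \<omega>)^4) (3 * (\<Sum>i\<in>I. (c i)\<^sup>2)\<^sup>2)"
proof -
  interpret prob_space M using Z by (simp add: std_normals_def)
  have "has_bochner_integral M L 0 \<and> has_bochner_integral M (\<lambda>\<omega>. (L \<omega>)\<^sup>2) (\<Sum>i\<in>I. (c i)\<^sup>2) \<and>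
      has_bochner_integral M (\<lambda>\<omega>. (L \<omega>)^4) (3 * (\<Sum>i\<in>I. (c i)\<^sup>2)\<^sup>2)"
  proof (cases "\<exists>i\<in>I. c i \<noteq> 0")
    case False
    then have "L = (\<lambda>_. 0)" "(\<Sum>i\<in>I. (c i)\<^sup>2) = 0" by (auto simp: L_def)
    then show ?thesis by (simp add: has_bochner_integral_zero)
  next
    case True
    define \<sigma> where "\<sigma> = sqrt (\<Sum>i\<in>I. (c i)\<^sup>2)"
    have pos: "(\<Sum>i\<in>I. (c i)\<^sup>2) > 0"
      using True I by (auto intro!: sum_pos2)
    have \<sigma>: "\<sigma> > 0" "\<sigma>\<^sup>2 = (\<Sum>i\<in>I. (c i)\<^sup>2)" using pos by (auto simp: \<sigma>_def)
    have d: "distributed M lborel L (normal_density 0 \<sigma>)"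
      unfolding L_def \<sigma>_def by (rule std_normals_linear_form[OF Z I True])
    have tr: "has_bochner_integral M (\<lambda>\<omega>. g (L \<omega>)) v"
      if "has_bochner_integral lborel (\<lambda>x. normal_density 0 \<sigma> x * g x) v"
        "g \<in> borel_measurable borel" for g :: "real \<Rightarrow> real" and v
      using that distributed_integrable[OF d, of g] distributed_integral[OF d, of g]
      by (auto simp: has_bochner_integral_iff normal_density_nonneg)
    \<comment> \<open>The general even moment is
      \<open>fact (2 * k) / ((2 / \<sigma>\<^sup>2) ^ k * fact k)\<close>; here \<open>k = 2\<close>
      and then \<open>k = 1\<close>.\<close>
    have "fact (2 * 2) / ((2 / \<sigma>\<^sup>2) ^ 2 * fact 2) = (3 * (\<sigma>\<^sup>2)\<^sup>2 :: real)"
      using \<sigma>(1) by (simp add: field_simps fact_numeral power2_eq_square)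
    moreover have "fact (2 * 1) / ((2 / \<sigma>\<^sup>2) ^ 1 * fact 1) = (\<sigma>\<^sup>2 :: real)"
      using \<sigma>(1) by (simp add: field_simps fact_numeral power2_eq_square)
    ultimately show ?thesis
      using tr[OF normal_moment_odd[OF \<sigma>(1), of 0 0, simplified]]
        tr[OF normal_moment_even[OF \<sigma>(1), of 0 1, simplified]]
        tr[OF normal_moment_even[OF \<sigma>(1), of 0 2, simplified]]
      unfolding \<sigma>(2)[symmetric] by simp
  qed
  then show "has_bochner_integral M L 0"
    and "has_bochner_integral M (\<lambda>\<omega>. (L \<omega>)\<^sup>2) (\<Sum>i\<in>I. (c i)\<^sup>2)"
    and "has_bochner_integral M (\<lambda>\<omega>. (L \<omega>)^4) (3 * (\<Sum>i\<in>I. (c i)\<^sup>2)\<^sup>2)" by auto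
qed

text \<open>The coordinates of a product of standard normal laws do it. This supplies the auxiliary
  copies for the exchange argument and the vectors \<open>g\<close> and \<open>h\<close> of the
  comparison process.\<close>

lemma std_normals_exist:
  "\<exists>(M :: ('i \<Rightarrow> real) measure) (Z :: 'i \<Rightarrow> _). std_normals M Z UNIV"
proof -
  let ?N = "density lborel std_normal_density"
  let ?P = "PiM (UNIV :: 'i set) (\<lambda>_. ?N)"
  interpret N: prob_space ?N by (rule prob_space_normal_density) simp
  interpret P: product_prob_space "\<lambda>_. ?N" "UNIV :: 'i set" by unfold_locales
  have m: "(\<lambda>\<omega>. \<omega> i) \<in> borel_measurable ?P" for i
  proof -
    have "(\<lambda>\<omega>. \<omega> i) \<in> measurable ?P ?N" by measurable
    then show ?thesis by simp
  qed
  have d: "distr ?P borel (\<lambda>\<omega>. \<omega> i) = ?N" for i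
  proof -
    have "distr ?P borel (\<lambda>\<omega>. \<omega> i) = distr ?P ?N (\<lambda>\<omega>. \<omega> i)"
      by (rule distr_cong) auto
    also have "\<dots> = ?N" by (rule P.PiM_component) simp
    finally show ?thesis .
  qed
  have "distributed ?P lborel (\<lambda>\<omega>. \<omega> i) std_normal_density" for i
    unfolding distributed_def
  proof (intro conjI)
    have "distr ?P lborel (\<lambda>\<omega>. \<omega> i) = distr ?P borel (\<lambda>\<omega>. \<omega> i)"
      by (rule distr_cong) auto
    then show "distr ?P lborel (\<lambda>\<omega>. \<omega> i) = ?N" using d by simp
  qed (use m[of i] in auto)
  moreover have "P.P.indep_vars (\<lambda>_. borel) (\<lambda>i \<omega>. \<omega> i) UNIV"
  proof (subst P.P.indep_vars_iff_distr_eq_PiM')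
    show "distr ?P (PiM UNIV (\<lambda>_. borel)) (\<lambda>x. \<lambda>i\<in>UNIV. x i) = (\<Pi>\<^sub>M i\<in>UNIV. distr ?P borel (\<lambda>\<omega>. \<omega> i))"
    proof -
      have "distr ?P (PiM UNIV (\<lambda>_. borel)) (\<lambda>x. \<lambda>i\<in>UNIV. x i) = distr ?P ?P (\<lambda>x. x)"
        by (rule distr_cong) (auto intro!: sets_PiM_cong)
      then show ?thesis by (simp add: d)
    qed
  qed (use m in auto)
  ultimately have "std_normals ?P (\<lambda>i \<omega>. \<omega> i) UNIV"
    by (auto simp: std_normals_def P.P.prob_space_axioms)
  then show ?thesis by blast
qed

text \<open>Independence makes the joint law the product of the marginals, so it is the same for
  both families. Expectations can therefore be moved from one probability space to another.\<close>

lemma std_normals_same_law: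
  assumes Z: "std_normals M Z I" and V: "std_normals N V I" and I: "I \<noteq> {}"
    and f: "f \<in> borel_measurable (PiM I (\<lambda>_. borel))"
  shows "(\<integral>\<omega>. f (\<lambda>i\<in>I. Z i \<omega>) \<partial>M) = (\<integral>\<omega>. f (\<lambda>i\<in>I. V i \<omega>) \<partial>N :: real)"
proof -
  have law: "distr M (PiM I (\<lambda>_. borel)) (\<lambda>\<omega>. \<lambda>i\<in>I. Z i \<omega>)
      = PiM I (\<lambda>_. density lborel std_normal_density)" (is "?l = _")
    if Z: "std_normals M Z I" for M :: "'x measure" and Z
  proof -
    interpret prob_space M using Z by (simp add: std_normals_def)
    have "?l = (\<Pi>\<^sub>M i\<in>I. distr M borel (Z i))"
      using Z I std_normals_measurable[OF Z]
      by (subst indep_vars_iff_distr_eq_PiM'[symmetric]) (auto simp: std_normals_def)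
    also have "\<dots> = PiM I (\<lambda>_. density lborel std_normal_density)"
    proof (rule PiM_cong[OF refl])
      fix i assume "i \<in> I"
      then have "distr M lborel (Z i) = density lborel std_normal_density"
        using Z by (auto simp: std_normals_def distributed_def)
      moreover have "distr M borel (Z i) = distr M lborel (Z i)"
        by (rule distr_cong) auto
      ultimately show "distr M borel (Z i) = density lborel std_normal_density" by simp
    qed
    finally show ?thesis .
  qed
  have m: "(\<lambda>\<omega>. \<lambda>i\<in>I. Z i \<omega>) \<in> measurable M (PiM I (\<lambda>_. borel))"
    if "std_normals M Z I" for M :: "'x measure" and Z
    using std_normals_measurable[OF that] by (intro measurable_restrict) auto
  show ?thesis
    using integral_distr[OF m[OF Z] f] integral_distr[OF m[OF V] f] law[OF Z] law[OF V] by simp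
qed

section \<open>Log-sum-exp\<close>

definition lse :: "'t set \<Rightarrow> ('t \<Rightarrow> real) \<Rightarrow> real" where
  "lse T z = ln (\<Sum>t\<in>T. exp (z t))"

text \<open>The gradient of \<open>lse T\<close> at \<open>z\<close>. For nonempty finite
  \<open>T\<close> it is a probability vector on \<open>T\<close>.\<close>

definition softmax :: "'t set \<Rightarrow> ('t \<Rightarrow> real) \<Rightarrow> 't \<Rightarrow> real" where
  "softmax T z t = exp (z t) / (\<Sum>s\<in>T. exp (z s))"

lemma lse_ge:
  assumes "finite T" "t \<in> T"
  shows "z t \<le> lse T z"
proof -
  have "exp (z t) \<le> (\<Sum>t\<in>T. exp (z t))"
    using assms by (intro member_le_sum) auto
  then show ?thesis
    unfolding lse_def by (metis exp_gt_zero ln_exp ln_le_cancel_iff order_less_le_trans)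
qed

lemma lse_le:
  assumes "finite T" "T \<noteq> {}" "\<And>t. t \<in> T \<Longrightarrow> z t \<le> m"
  shows "lse T z \<le> m + ln (card T)"
proof -
  have "(\<Sum>t\<in>T. exp (z t)) \<le> card T * exp m"
    using assms sum_bounded_above[of T "\<lambda>t. exp (z t)" "exp m"] by simp
  moreover have "0 < (\<Sum>t\<in>T. exp (z t))"
    using assms by (intro sum_pos) auto
  ultimately have "lse T z \<le> ln (card T * exp m)"
    unfolding lse_def by (meson ln_le_cancel_iff order_less_le_trans)
  also have "\<dots> = m + ln (card T)"
    using assms by (simp add: ln_mult card_gt_0_iff)
  finally show ?thesis .
qed

lemma abs_lse_le:
  assumes T: "finite T" "T \<noteq> {}"
  shows "\<bar>lse T z\<bar> \<le> (\<Sum>t\<in>T. \<bar>z t\<bar>) + ln (card T)"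
proof -
  obtain t where t: "t \<in> T" using T by blast
  have le: "\<bar>z s\<bar> \<le> (\<Sum>t\<in>T. \<bar>z t\<bar>)" if "s \<in> T" for s
    using T that by (intro member_le_sum) auto
  have "lse T z \<le> (\<Sum>t\<in>T. \<bar>z t\<bar>) + ln (card T)"
    using le by (intro lse_le T) fastforce
  moreover have "- (\<Sum>t\<in>T. \<bar>z t\<bar>) \<le> lse T z"
    using le[OF t] lse_ge[OF T(1) t, of z] by linarith
  moreover have "1 \<le> card T" using T by (simp add: Suc_leI card_gt_0_iff)
  then have "ln (card T) \<ge> 0" by simp
  ultimately show ?thesis by linarith
qed

lemma softmax_bounds:
  assumes "finite T" "t \<in> T"
  shows "0 \<le> softmax T z t" "softmax T z t \<le> 1"
proof -
  have "exp (z t) \<le> (\<Sum>t\<in>T. exp (z t))"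
    using assms by (intro member_le_sum) auto
  moreover from this have "0 < (\<Sum>t\<in>T. exp (z t))" by (rule less_le_trans[OF exp_gt_zero])
  ultimately show "softmax T z t \<le> 1" "0 \<le> softmax T z t"
    unfolding softmax_def by (auto simp: divide_simps intro: sum_nonneg)
qed

lemma sum_softmax:
  assumes "finite T" "T \<noteq> {}"
  shows "(\<Sum>t\<in>T. softmax T z t) = 1"
proof -
  have "0 < (\<Sum>t\<in>T. exp (z t))"
    using assms by (intro sum_pos) auto
  then show ?thesis
    unfolding softmax_def sum_divide_distrib[symmetric] by simp
qed

text \<open>The variance under the weights \<open>p\<close> seen through increments only. This is
  why the comparison needs an ordering of the second moments of increments and not of the
  covariances themselves.\<close>

lemma variance_as_pair_sum:
  fixes p x :: "'t \<Rightarrow> real"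
  assumes "(\<Sum>t\<in>T. p t) = 1"
  shows "(\<Sum>s\<in>T. \<Sum>t\<in>T. p s * p t * (x s - x t)\<^sup>2)
    = 2 * ((\<Sum>t\<in>T. p t * (x t)\<^sup>2) - (\<Sum>t\<in>T. p t * x t)\<^sup>2)"
proof -
  have "(\<Sum>s\<in>T. \<Sum>t\<in>T. p s * p t * (x s - x t)\<^sup>2)
      = (\<Sum>s\<in>T. \<Sum>t\<in>T. (p s * (x s)\<^sup>2) * p t) + (\<Sum>s\<in>T. \<Sum>t\<in>T. p s * (p t * (x t)\<^sup>2))
        - 2 * (\<Sum>s\<in>T. \<Sum>t\<in>T. (p s * x s) * (p t * x t))"
    unfolding sum_distrib_left sum.distrib[symmetric] sum_subtractf[symmetric]
    by (intro sum.cong refl) (simp add: power2_eq_square algebra_simps)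
  also have "\<dots> = 2 * ((\<Sum>t\<in>T. p t * (x t)\<^sup>2) - (\<Sum>t\<in>T. p t * x t)\<^sup>2)"
    unfolding sum_product[symmetric] assms by (simp add: power2_eq_square)
  finally show ?thesis .
qed

text \<open>Along the segment from \<open>z\<close> to \<open>z + x\<close>, the derivatives of
  log-sum-exp are the cumulants of \<open>x\<close> under the softmax weights. The second one is a
  variance, rewritten as a pair sum, and the third one bounds the remainder.\<close>

lemma lse_taylor:
  assumes T: "finite T" "T \<noteq> {}"
  shows "\<bar>lse T (\<lambda>t. z t + x t) - lse T z - (\<Sum>t\<in>T. softmax T z t * x t)
      - (\<Sum>s\<in>T. \<Sum>t\<in>T. softmax T z s * softmax T z t * (x s - x t)\<^sup>2) / 4\<bar>
    \<le> (\<Sum>t\<in>T. \<bar>x t\<bar>^3)"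
proof -
  \<comment> \<open>\<open>A j s\<close> is the unnormalised and \<open>R j s\<close> the normalised
    \<open>j\<close>-th moment of \<open>x\<close> under the weights at
    \<open>z + s x\<close>.\<close>
  define A where "A j s = (\<Sum>t\<in>T. x t^j * exp (z t + s * x t))" for j :: nat and s :: real
  define R where "R j s = A j s / A 0 s" for j s
  have A0: "A 0 s > 0" for s using T by (auto simp: A_def intro!: sum_pos)
  have dA: "(A j has_real_derivative A (Suc j) s) (at s)" for j s
    unfolding A_def by (auto intro!: derivative_eq_intros sum.cong)
  have dR: "(R j has_real_derivative R (Suc j) s - R j s * R 1 s) (at s)" for j s
  proof -
    have "((\<lambda>s. A j s / A 0 s) has_real_derivative
        (A (Suc j) s * A 0 s - A j s * A (Suc 0) s) / (A 0 s * A 0 s)) (at s)"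
      using A0[of s] by (intro DERIV_divide dA) auto
    then show ?thesis using A0[of s] by (simp add: R_def[abs_def] field_simps)
  qed
  \<comment> \<open>The successive derivatives of \<open>ln (A 0 s)\<close>: for \<open>m\<close>
    from 1 to 3 these are the first three cumulants.\<close>
  define d where "d m s = (if m = 0 then ln (A 0 s) else if m = 1 then R 1 s
      else if m = 2 then R 2 s - (R 1 s)\<^sup>2
      else R 3 s - 3 * R 2 s * R 1 s + 2 * (R 1 s)^3)" for m :: nat and s
  have "\<exists>t>0. t < 1 \<and> ln (A 0 1) = (\<Sum>m<3. d m 0 / fact m * 1 ^ m) + d 3 t / fact 3 * 1 ^ 3"
  proof (rule Maclaurin)
    show "d 0 = (\<lambda>s. ln (A 0 s))" by (simp add: d_def fun_eq_iff)
    show "\<forall>m t. m < 3 \<and> 0 \<le> t \<and> t \<le> 1 \<longrightarrow> (d m has_real_derivative d (Suc m) t) (at t)"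
    proof (intro allI impI)
      fix m :: nat and s :: real assume "m < 3 \<and> 0 \<le> s \<and> s \<le> 1"
      then consider "m = 0" | "m = 1" | "m = 2" by linarith
      then show "(d m has_real_derivative d (Suc m) s) (at s)"
      proof cases
        case 1
        have "((\<lambda>s. ln (A 0 s)) has_real_derivative R 1 s) (at s)"
          using A0[of s] by (auto intro!: derivative_eq_intros dA simp: R_def)
        with 1 show ?thesis by (simp add: d_def[abs_def])
      next
        case 2
        with dR[of 1 s] show ?thesis by (simp add: d_def[abs_def] power2_eq_square numeral_2_eq_2)
      next
        case 3
        have "((\<lambda>s. R 2 s - (R 1 s)\<^sup>2) has_real_derivative
            (R 3 s - R 2 s * R 1 s) - 2 * R 1 s * (R 2 s - R 1 s * R 1 s)) (at s)"
          using dR[of 1 s] dR[of 2 s]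
          by (auto intro!: derivative_eq_intros simp: numeral_3_eq_3 numeral_2_eq_2)
        also have "(R 3 s - R 2 s * R 1 s) - 2 * R 1 s * (R 2 s - R 1 s * R 1 s) = d 3 s"
          by (simp add: d_def power3_eq_cube algebra_simps)
        finally show ?thesis using 3 by (simp add: d_def[abs_def])
      qed
    qed
  qed auto
  then obtain s where eq: "ln (A 0 1) = (\<Sum>m<3. d m 0 / fact m) + d 3 s / 6"
    by (auto simp: fact_numeral)
  obtain u where u: "u \<in> T" "\<And>t. t \<in> T \<Longrightarrow> \<bar>x t\<bar> \<le> \<bar>x u\<bar>"
    using obtains_MAX[OF T, of "\<lambda>t. \<bar>x t\<bar>"] T by (metis Max_ge finite_imageI image_eqI)
  define b where "b = \<bar>x u\<bar>"
  have b: "b \<ge> 0" by (simp add: b_def)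
  have R: "\<bar>R j s\<bar> \<le> b^j" for j
  proof -
    have "\<bar>A j s\<bar> \<le> (\<Sum>t\<in>T. \<bar>x t^j * exp (z t + s * x t)\<bar>)"
      unfolding A_def by (rule sum_abs)
    also have "\<dots> \<le> (\<Sum>t\<in>T. b^j * exp (z t + s * x t))"
      using u by (intro sum_mono) (auto simp: abs_mult power_abs b_def intro!: mult_right_mono power_mono)
    also have "\<dots> = b^j * A 0 s" by (simp add: A_def sum_distrib_left)
    finally show ?thesis using A0[of s] by (simp add: R_def field_simps)
  qed
  have "\<bar>R 2 s * R 1 s\<bar> \<le> b^2 * b^1"
    unfolding abs_mult using R b by (intro mult_mono) (simp_all only: zero_le_power abs_ge_zero)
  moreover have "\<bar>(R 1 s)^3\<bar> \<le> b^3"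
    unfolding power_abs using R[of 1] b by (intro power_mono) simp_all
  \<comment> \<open>The coefficients of the third cumulant add up to \<open>1 + 3 + 2 = 6\<close>,
    which cancels the factorial in the remainder.\<close>
  ultimately have "\<bar>d 3 s\<bar> \<le> 6 * b^3"
    using R[of 3] unfolding d_def by (simp add: power2_eq_square power3_eq_cube)
  also have "b^3 \<le> (\<Sum>t\<in>T. \<bar>x t\<bar>^3)"
    unfolding b_def using T u(1) by (intro member_le_sum) auto
  finally have d3: "\<bar>d 3 s / 6\<bar> \<le> (\<Sum>t\<in>T. \<bar>x t\<bar>^3)" by simp
  have R0: "R j 0 = (\<Sum>t\<in>T. softmax T z t * x t^j)" for j
    by (simp add: R_def A_def softmax_def sum_divide_distrib mult.commute)
  have "(\<Sum>m<3. d m 0 / fact m) = lse T z + R 1 0 + (R 2 0 - (R 1 0)\<^sup>2) / 2"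
    by (simp add: numeral_3_eq_3 d_def A_def lse_def)
  \<comment> \<open>The pair sum is twice the variance, so the factor 1/2 of the second-order term
    becomes 1/4.\<close>
  also have "R 2 0 - (R 1 0)\<^sup>2 = (\<Sum>s\<in>T. \<Sum>t\<in>T. softmax T z s * softmax T z t * (x s - x t)\<^sup>2) / 2"
    unfolding R0 variance_as_pair_sum[OF sum_softmax[OF T]] by simp
  finally have "lse T (\<lambda>t. z t + x t) = lse T z + (\<Sum>t\<in>T. softmax T z t * x t)
      + (\<Sum>s\<in>T. \<Sum>t\<in>T. softmax T z s * softmax T z t * (x s - x t)\<^sup>2) / 4 + d 3 s / 6"
    using eq R0[of 1] by (simp add: A_def lse_def)
  with d3 show ?thesis by simp
qed

lemma borel_measurable_lse [measurable]:
  assumes "finite T" "\<And>t. t \<in> T \<Longrightarrow> z t \<in> borel_measurable M"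
  shows "(\<lambda>\<omega>. lse T (\<lambda>t. z t \<omega>)) \<in> borel_measurable M"
  unfolding lse_def using assms by measurable

lemma borel_measurable_softmax [measurable]:
  assumes "finite T" "t \<in> T" "\<And>t. t \<in> T \<Longrightarrow> z t \<in> borel_measurable M"
  shows "(\<lambda>\<omega>. softmax T (\<lambda>t. z t \<omega>) t) \<in> borel_measurable M"
  unfolding softmax_def using assms by measurable

lemma integrable_lse:
  fixes z :: "'t \<Rightarrow> 'a \<Rightarrow> real"
  assumes "prob_space M" and T: "finite T" "T \<noteq> {}" and z: "\<And>t. t \<in> T \<Longrightarrow> integrable M (z t)"
  shows "integrable M (\<lambda>\<omega>. lse T (\<lambda>t. z t \<omega>))"
proof -
  interpret prob_space M by fact
  show ?thesis
  proof (rule Bochner_Integration.integrable_bound)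
    show "integrable M (\<lambda>\<omega>. (\<Sum>t\<in>T. \<bar>z t \<omega>\<bar>) + ln (card T))"
      using z by (intro Bochner_Integration.integrable_add Bochner_Integration.integrable_sum) auto
    show "AE \<omega> in M. norm (lse T (\<lambda>t. z t \<omega>)) \<le> norm ((\<Sum>t\<in>T. \<bar>z t \<omega>\<bar>) + ln (card T))"
      using order_trans[OF abs_lse_le[OF T] abs_ge_self] by simp
  qed (use T z in \<open>auto intro!: borel_measurable_lse\<close>)
qed

text \<open>The expansion of \<open>lse_taylor\<close> is integrated term by term. As the softmax
  weights depend on \<open>z\<close> alone, they are independent of \<open>x\<close>: the linear
  term vanishes by centring, and the quadratic term sees \<open>x\<close> only through
  \<open>D\<close>.\<close>

lemma expectation_lse_add:
  fixes z x :: "'t \<Rightarrow> 'a \<Rightarrow> real"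
  assumes M: "prob_space M" and T: "finite T" "T \<noteq> {}"
    and indep: "prob_space.indep_var M (PiM T (\<lambda>_. borel)) (\<lambda>\<omega>. \<lambda>t\<in>T. z t \<omega>)
      (PiM T (\<lambda>_. borel)) (\<lambda>\<omega>. \<lambda>t\<in>T. x t \<omega>)"
    and z: "\<And>t. t \<in> T \<Longrightarrow> integrable M (z t)"
    and x: "\<And>t. t \<in> T \<Longrightarrow> has_bochner_integral M (x t) 0"
    and D: "\<And>s t. s \<in> T \<Longrightarrow> t \<in> T \<Longrightarrow> has_bochner_integral M (\<lambda>\<omega>. (x s \<omega> - x t \<omega>)\<^sup>2) (D s t)"
    and x3: "\<And>t. t \<in> T \<Longrightarrow> integrable M (\<lambda>\<omega>. \<bar>x t \<omega>\<bar>^3)"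
  defines "p \<equiv> \<lambda>t \<omega>. softmax T (\<lambda>t. z t \<omega>) t"
  shows "\<bar>(\<integral>\<omega>. lse T (\<lambda>t. z t \<omega> + x t \<omega>) \<partial>M) - (\<integral>\<omega>. lse T (\<lambda>t. z t \<omega>) \<partial>M)
      - (\<Sum>s\<in>T. \<Sum>t\<in>T. (\<integral>\<omega>. p s \<omega> * p t \<omega> \<partial>M) * D s t) / 4\<bar> \<le> (\<Sum>t\<in>T. \<integral>\<omega>. \<bar>x t \<omega>\<bar>^3 \<partial>M)"
proof -
  interpret prob_space M by fact
  have zm: "z t \<in> borel_measurable M" if "t \<in> T" for t using z[OF that] by auto
  have pm: "p t \<in> borel_measurable M" if "t \<in> T" for t
    unfolding p_def using T(1) that zm by (rule borel_measurable_softmax)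
  have pb: "0 \<le> p t \<omega>" "p t \<omega> \<le> 1" if "t \<in> T" for t \<omega>
    unfolding p_def using softmax_bounds[OF T(1) that] by auto
  have pi: "integrable M (p t)" if "t \<in> T" for t
    using pm[OF that] pb[OF that] by (intro integrable_const_bound[where B=1]) auto
  have ppi: "integrable M (\<lambda>\<omega>. p s \<omega> * p t \<omega>)" if "s \<in> T" "t \<in> T" for s t
    using pm pb that by (intro integrable_const_bound[where B=1])
      (auto simp: abs_mult intro!: mult_le_one)
  \<comment> \<open>Independence is stated for families restricted to \<open>T\<close>; the softmax
    weights do not notice the restriction.\<close>
  have rs: "softmax T (restrict f T) t = softmax T f t" if "t \<in> T" for f :: "'t \<Rightarrow> real" and t
    using that by (simp add: softmax_def)
  have i1: "indep_var borel (p t) borel (x t)" if "t \<in> T" for t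
    using indep_var_compose[OF indep, of "\<lambda>f. softmax T f t" borel "\<lambda>f. f t" borel] that T
    by (simp add: o_def rs p_def borel_measurable_softmax)
  have i2: "indep_var borel (\<lambda>\<omega>. p s \<omega> * p t \<omega>) borel (\<lambda>\<omega>. (x s \<omega> - x t \<omega>)\<^sup>2)"
    if "s \<in> T" "t \<in> T" for s t
  proof -
    have "(\<lambda>f. softmax T f s * softmax T f t) \<in> borel_measurable (PiM T (\<lambda>_. borel))"
      using T that by (intro borel_measurable_times borel_measurable_softmax) auto
    moreover have "(\<lambda>f. (f s - f t)\<^sup>2) \<in> borel_measurable (PiM T (\<lambda>_. borel :: real measure))"
      using that by measurable
    ultimately show ?thesis
      using indep_var_compose[OF indep, of "\<lambda>f. softmax T f s * softmax T f t" borel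
          "\<lambda>f. (f s - f t)\<^sup>2" borel] that
      by (simp add: o_def rs p_def)
  qed
  have e1: "has_bochner_integral M (\<lambda>\<omega>. p t \<omega> * x t \<omega>) 0" if "t \<in> T" for t
    using indep_var_lebesgue_integral[OF i1[OF that] pi[OF that]]
      indep_var_integrable[OF i1[OF that] pi[OF that]] x[OF that]
    by (simp add: has_bochner_integral_iff)
  have e2: "has_bochner_integral M (\<lambda>\<omega>. p s \<omega> * p t \<omega> * (x s \<omega> - x t \<omega>)\<^sup>2)
      ((\<integral>\<omega>. p s \<omega> * p t \<omega> \<partial>M) * D s t)" if "s \<in> T" "t \<in> T" for s t
    using indep_var_lebesgue_integral[OF i2[OF that] ppi[OF that]]
      indep_var_integrable[OF i2[OF that] ppi[OF that]] D[OF that]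
    by (simp add: has_bochner_integral_iff)
  have l0: "integrable M (\<lambda>\<omega>. lse T (\<lambda>t. z t \<omega>))"
    by (rule integrable_lse[OF M T z])
  have l1: "integrable M (\<lambda>\<omega>. lse T (\<lambda>t. z t \<omega> + x t \<omega>))"
    using z x by (intro integrable_lse[OF M T]) (auto simp: has_bochner_integral_iff)
  let ?R = "\<lambda>\<omega>. lse T (\<lambda>t. z t \<omega> + x t \<omega>) - lse T (\<lambda>t. z t \<omega>) - (\<Sum>t\<in>T. p t \<omega> * x t \<omega>)
      - (\<Sum>s\<in>T. \<Sum>t\<in>T. p s \<omega> * p t \<omega> * (x s \<omega> - x t \<omega>)\<^sup>2) / 4"
  have R: "has_bochner_integral M ?R ((\<integral>\<omega>. lse T (\<lambda>t. z t \<omega> + x t \<omega>) \<partial>M) - (\<integral>\<omega>. lse T (\<lambda>t. z t \<omega>) \<partial>M)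
      - (\<Sum>t\<in>T. 0) - (\<Sum>s\<in>T. \<Sum>t\<in>T. (\<integral>\<omega>. p s \<omega> * p t \<omega> \<partial>M) * D s t) / 4)"
    using l0 l1 e1 e2
    by (intro has_bochner_integral_diff has_bochner_integral_sum has_bochner_integral_divide
        has_bochner_integral_divide_zero has_bochner_integral_integrable) auto
  have "\<bar>\<integral>\<omega>. ?R \<omega> \<partial>M\<bar> \<le> (\<integral>\<omega>. (\<Sum>t\<in>T. \<bar>x t \<omega>\<bar>^3) \<partial>M)"
  proof (rule order_trans[OF integral_abs_bound integral_mono])
    show "integrable M (\<lambda>\<omega>. \<bar>?R \<omega>\<bar>)" using R by (auto simp: has_bochner_integral_iff)
    show "integrable M (\<lambda>\<omega>. \<Sum>t\<in>T. \<bar>x t \<omega>\<bar>^3)" using x3 by simp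
    show "\<bar>?R \<omega>\<bar> \<le> (\<Sum>t\<in>T. \<bar>x t \<omega>\<bar>^3)" for \<omega>
      unfolding p_def by (rule lse_taylor[OF T])
  qed
  also have "\<dots> = (\<Sum>t\<in>T. \<integral>\<omega>. \<bar>x t \<omega>\<bar>^3 \<partial>M)"
    using x3 by (rule Bochner_Integration.integral_sum)
  finally show ?thesis
    using has_bochner_integral_integral_eq[OF R] by simp
qed

text \<open>Stability of the normal law under normalised sums. The blocks of indices are disjoint
  because \<open>e\<close> is injective, so the averages stay independent. Read backwards, a
  Gaussian family splits into \<open>N\<close> small independent pieces.\<close>

lemma std_normals_block_average:
  fixes Z :: "nat \<times> 'c \<Rightarrow> 'a \<Rightarrow> real" and e :: "'i \<Rightarrow> 'c"
  assumes Z: "std_normals M Z UNIV" and e: "inj e" and N: "N > 0"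
  shows "std_normals M (\<lambda>i \<omega>. \<Sum>r<N. Z (r, e i) \<omega> / sqrt N) UNIV"
proof -
  interpret prob_space M using Z by (simp add: std_normals_def)
  let ?K = "\<lambda>i. {..<N} \<times> {e i}"
  have "indep_vars (\<lambda>_. borel) (\<lambda>i \<omega>. \<Sum>r<N. (\<lambda>q\<in>?K i. Z q \<omega>) (r, e i) / sqrt N) UNIV"
  proof (rule indep_vars_compose2[where Y = "\<lambda>i f. \<Sum>r<N. f (r, e i) / sqrt N"])
    show "indep_vars (\<lambda>i. PiM (?K i) (\<lambda>_. borel)) (\<lambda>i \<omega>. \<lambda>q\<in>?K i. Z q \<omega>) UNIV"
      using Z e by (intro indep_vars_restrict[of "\<lambda>_. borel" Z UNIV])
        (auto simp: std_normals_def disjoint_family_on_def inj_def)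
  qed simp
  then have "indep_vars (\<lambda>_. borel) (\<lambda>i \<omega>. \<Sum>r<N. Z (r, e i) \<omega> / sqrt N) UNIV"
    by simp
  moreover have "distributed M lborel (\<lambda>\<omega>. \<Sum>r<N. Z (r, e i) \<omega> / sqrt N) std_normal_density" for i
  proof -
    have s: "(\<Sum>q\<in>?K i. g q) = (\<Sum>r<N. g (r, e i))" for g :: "nat \<times> 'c \<Rightarrow> real"
      using sum.cartesian_product[of "\<lambda>r q. g (r, q)" "{e i}" "{..<N}"] by simp
    have "distributed M lborel (\<lambda>\<omega>. \<Sum>q\<in>?K i. (1 / sqrt N) * Z q \<omega>)
        (normal_density 0 (sqrt (\<Sum>q\<in>?K i. (1 / sqrt N)\<^sup>2)))"
      using N by (intro std_normals_linear_form[OF std_normals_subset[OF Z]]) auto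
    then show ?thesis using N by (simp add: s power_divide)
  qed
  ultimately show ?thesis using Z by (simp add: std_normals_def)
qed

section \<open>Gaussian comparison\<close>

text \<open>Both expectations are expanded around the same \<open>z\<close>. The weights of the
  quadratic terms are nonnegative, so these terms inherit the order of \<open>D\<close> and
  \<open>E\<close>, and only the third-order errors remain.\<close>

lemma expectation_lse_add_mono:
  fixes z x y :: "'t \<Rightarrow> 'a \<Rightarrow> real"
  assumes M: "prob_space M" and T: "finite T" "T \<noteq> {}"
    and indep: "prob_space.indep_var M (PiM T (\<lambda>_. borel)) (\<lambda>\<omega>. \<lambda>t\<in>T. z t \<omega>)
      (PiM T (\<lambda>_. borel)) (\<lambda>\<omega>. \<lambda>t\<in>T. x t \<omega>)"
      "prob_space.indep_var M (PiM T (\<lambda>_. borel)) (\<lambda>\<omega>. \<lambda>t\<in>T. z t \<omega>)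
      (PiM T (\<lambda>_. borel)) (\<lambda>\<omega>. \<lambda>t\<in>T. y t \<omega>)"
    and z: "\<And>t. t \<in> T \<Longrightarrow> integrable M (z t)"
    and x: "\<And>t. t \<in> T \<Longrightarrow> has_bochner_integral M (x t) 0"
      "\<And>s t. s \<in> T \<Longrightarrow> t \<in> T \<Longrightarrow> has_bochner_integral M (\<lambda>\<omega>. (x s \<omega> - x t \<omega>)\<^sup>2) (D s t)"
      "\<And>t. t \<in> T \<Longrightarrow> integrable M (\<lambda>\<omega>. \<bar>x t \<omega>\<bar>^3)"
    and y: "\<And>t. t \<in> T \<Longrightarrow> has_bochner_integral M (y t) 0"
      "\<And>s t. s \<in> T \<Longrightarrow> t \<in> T \<Longrightarrow> has_bochner_integral M (\<lambda>\<omega>. (y s \<omega> - y t \<omega>)\<^sup>2) (E s t)"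
      "\<And>t. t \<in> T \<Longrightarrow> integrable M (\<lambda>\<omega>. \<bar>y t \<omega>\<bar>^3)"
    and le: "\<And>s t. s \<in> T \<Longrightarrow> t \<in> T \<Longrightarrow> D s t \<le> E s t"
  shows "(\<integral>\<omega>. lse T (\<lambda>t. z t \<omega> + x t \<omega>) \<partial>M) \<le> (\<integral>\<omega>. lse T (\<lambda>t. z t \<omega> + y t \<omega>) \<partial>M)
    + (\<Sum>t\<in>T. (\<integral>\<omega>. \<bar>x t \<omega>\<bar>^3 \<partial>M) + (\<integral>\<omega>. \<bar>y t \<omega>\<bar>^3 \<partial>M))"
proof -
  let ?q = "\<lambda>s t. \<integral>\<omega>. softmax T (\<lambda>t. z t \<omega>) s * softmax T (\<lambda>t. z t \<omega>) t \<partial>M"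
  have "?q s t \<ge> 0" if "s \<in> T" "t \<in> T" for s t
    using softmax_bounds(1)[OF T(1)] that by (intro integral_nonneg_AE) auto
  then have "(\<Sum>s\<in>T. \<Sum>t\<in>T. ?q s t * D s t) \<le> (\<Sum>s\<in>T. \<Sum>t\<in>T. ?q s t * E s t)"
    using le by (intro sum_mono mult_left_mono) auto
  then show ?thesis
    using expectation_lse_add[OF M T indep(1) z x] expectation_lse_add[OF M T indep(2) z y]
    unfolding sum.distrib abs_le_iff by linarith
qed

lemma abs_cube_le: "\<bar>x\<bar>^3 \<le> 1 + (x::real)^4"
proof (cases "\<bar>x\<bar> \<le> 1")
  case True
  then have "\<bar>x\<bar>^3 \<le> 1" by (simp add: power_le_one)
  then show ?thesis by (simp add: add_increasing2)
next
  case False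
  then have "\<bar>x\<bar>^3 \<le> \<bar>x\<bar>^4" by (intro power_increasing) auto
  then show ?thesis by simp
qed

text \<open>The third absolute moment is dominated through the fourth. A crude constant is enough,
  since it enters only an error that tends to zero with the number of copies.\<close>

lemma std_normals_linear_form_cube:
  fixes c :: "'i \<Rightarrow> real"
  assumes Z: "std_normals M Z I" and I: "finite I"
  defines "L \<equiv> \<lambda>\<omega>. \<Sum>i\<in>I. c i * Z i \<omega>"
  shows "integrable M (\<lambda>\<omega>. \<bar>L \<omega>\<bar>^3)"
    and "(\<integral>\<omega>. \<bar>L \<omega>\<bar>^3 \<partial>M) \<le> 1 + 3 * (\<Sum>i\<in>I. (c i)\<^sup>2)\<^sup>2"
proof -
  interpret prob_space M using Z by (simp add: std_normals_def)
  note m4 = std_normals_linear_form_moments(3)[OF Z I, of c]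
  have i4: "integrable M (\<lambda>\<omega>. 1 + (L \<omega>)^4)"
    using m4 by (auto simp: has_bochner_integral_iff L_def)
  have "L \<in> borel_measurable M"
    using std_normals_linear_form_moments(1)[OF Z I, of c]
    by (auto simp: has_bochner_integral_iff L_def)
  then show i3: "integrable M (\<lambda>\<omega>. \<bar>L \<omega>\<bar>^3)"
    using abs_cube_le by (intro Bochner_Integration.integrable_bound[OF i4]) auto
  have "(\<integral>\<omega>. \<bar>L \<omega>\<bar>^3 \<partial>M) \<le> (\<integral>\<omega>. 1 + (L \<omega>)^4 \<partial>M)"
    using i3 i4 abs_cube_le by (intro integral_mono) auto
  also have "\<dots> = 1 + 3 * (\<Sum>i\<in>I. (c i)\<^sup>2)\<^sup>2"
    using m4 by (simp add: has_bochner_integral_iff prob_space L_def)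
  finally show "(\<integral>\<omega>. \<bar>L \<omega>\<bar>^3 \<partial>M) \<le> 1 + 3 * (\<Sum>i\<in>I. (c i)\<^sup>2)\<^sup>2" .
qed

lemma std_normals_reindex:
  assumes Z: "std_normals M Z UNIV" and e: "inj e"
  shows "std_normals M (\<lambda>i. Z (e i)) UNIV"
proof -
  interpret prob_space M using Z by (simp add: std_normals_def)
  have "indep_vars (\<lambda>_. borel) (\<lambda>i \<omega>. (\<lambda>q\<in>{e i}. Z q \<omega>) (e i)) UNIV"
  proof (rule indep_vars_compose2[where Y = "\<lambda>i f. f (e i)"
        and X = "\<lambda>i \<omega>. \<lambda>q\<in>{e i}. Z q \<omega>" and M' = "\<lambda>i. PiM {e i} (\<lambda>_. borel)"])
    show "indep_vars (\<lambda>i. PiM {e i} (\<lambda>_. borel)) (\<lambda>i \<omega>. \<lambda>q\<in>{e i}. Z q \<omega>) UNIV"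
      using Z e by (intro indep_vars_restrict[of "\<lambda>_. borel" Z UNIV])
        (auto simp: std_normals_def disjoint_family_on_def inj_def)
  qed simp
  then show ?thesis using Z by (simp add: std_normals_def)
qed

text \<open>The Lindeberg exchange: of \<open>N\<close> independent copies of the two families, the \<open>l\<close>-th ones are
  swapped. One swap costs \<open>O(N powr (-3/2))\<close>, because both families are centred and the second
  moments of their increments are ordered.\<close>

lemma lindeberg_exchange:
  fixes Z :: "nat \<times> ('i::finite + 'j::finite) \<Rightarrow> 'a \<Rightarrow> real"
    and a :: "'t \<Rightarrow> 'i \<Rightarrow> real" and b :: "'t \<Rightarrow> 'j \<Rightarrow> real" and N :: nat
  assumes Z: "std_normals M Z UNIV" and T: "finite T" "T \<noteq> {}" and N: "N > 0"
    and le: "\<And>s t. s \<in> T \<Longrightarrow> t \<in> T \<Longrightarrow>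
      (\<Sum>i\<in>UNIV. (a s i - a t i)\<^sup>2) \<le> (\<Sum>j\<in>UNIV. (b s j - b t j)\<^sup>2)"
  defines "\<xi> \<equiv> \<lambda>r t f. \<Sum>i\<in>UNIV. a t i / sqrt N * f (r, Inl i)"
    and "\<eta> \<equiv> \<lambda>r t f. \<Sum>j\<in>UNIV. b t j / sqrt N * f (r, Inr j)"
    and "K \<equiv> \<Sum>t\<in>T. 2 + 3 * (\<Sum>i\<in>UNIV. (a t i)\<^sup>2)\<^sup>2 + 3 * (\<Sum>j\<in>UNIV. (b t j)\<^sup>2)\<^sup>2"
  shows "(\<integral>\<omega>. lse T (\<lambda>t. \<Sum>r<N. \<xi> r t (\<lambda>q. Z q \<omega>)) \<partial>M)
    \<le> (\<integral>\<omega>. lse T (\<lambda>t. \<Sum>r<N. \<eta> r t (\<lambda>q. Z q \<omega>)) \<partial>M) + K / sqrt N"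
proof -
  interpret prob_space M using Z by (simp add: std_normals_def)
  \<comment> \<open>The hybrid expectation: copies below \<open>l\<close> come from
    \<open>\<xi>\<close>, the others from \<open>\<eta>\<close>. Thus \<open>A 0\<close> belongs to
    \<open>\<eta>\<close> and \<open>A N\<close> to \<open>\<xi>\<close>.\<close>
  define A where "A l = (\<integral>\<omega>. lse T (\<lambda>t. \<Sum>r<N. (if r < l then \<xi> else \<eta>) r t (\<lambda>q. Z q \<omega>)) \<partial>M)" for l
  have Zl: "std_normals M (\<lambda>i. Z (r, Inl i)) UNIV" for r
    by (rule std_normals_reindex[OF Z]) (auto simp: inj_def)
  have Zr: "std_normals M (\<lambda>j. Z (r, Inr j)) UNIV" for r
    by (rule std_normals_reindex[OF Z]) (auto simp: inj_def)
  have x1: "has_bochner_integral M (\<lambda>\<omega>. \<xi> r t (\<lambda>q. Z q \<omega>)) 0" for r t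
    unfolding \<xi>_def by (rule std_normals_linear_form_moments(1)[OF Zl]) simp
  have y1: "has_bochner_integral M (\<lambda>\<omega>. \<eta> r t (\<lambda>q. Z q \<omega>)) 0" for r t
    unfolding \<eta>_def by (rule std_normals_linear_form_moments(1)[OF Zr]) simp
  have x2: "has_bochner_integral M (\<lambda>\<omega>. (\<xi> r s (\<lambda>q. Z q \<omega>) - \<xi> r t (\<lambda>q. Z q \<omega>))\<^sup>2)
      ((\<Sum>i\<in>UNIV. (a s i - a t i)\<^sup>2) / N)" for r s t
    using std_normals_linear_form_moments(2)[OF Zl finite, of "\<lambda>i. (a s i - a t i) / sqrt N"]
    by (simp add: \<xi>_def sum_subtractf[symmetric] diff_divide_distrib left_diff_distrib
        power_divide sum_divide_distrib[symmetric] flip: diff_divide_distrib)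
  have y2: "has_bochner_integral M (\<lambda>\<omega>. (\<eta> r s (\<lambda>q. Z q \<omega>) - \<eta> r t (\<lambda>q. Z q \<omega>))\<^sup>2)
      ((\<Sum>i\<in>UNIV. (b s i - b t i)\<^sup>2) / N)" for r s t
    using std_normals_linear_form_moments(2)[OF Zr finite, of "\<lambda>i. (b s i - b t i) / sqrt N"]
    by (simp add: \<eta>_def sum_subtractf[symmetric] diff_divide_distrib left_diff_distrib
        power_divide sum_divide_distrib[symmetric] flip: diff_divide_distrib)
  have scale: "(\<Sum>i\<in>UNIV. c i / sqrt N * f i) = (\<Sum>i\<in>UNIV. c i * f i) / sqrt N"
    for c f :: "'x::finite \<Rightarrow> real"
    by (simp add: sum_divide_distrib)
  \<comment> \<open>The scaling by \<open>1 / sqrt N\<close> makes each third moment of order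
    \<open>1 / (N * sqrt N)\<close>, small enough to be summed over \<open>N\<close> swaps.\<close>
  have cube: "\<bar>u / sqrt N\<bar>^3 = \<bar>u\<bar>^3 / (N * sqrt N)" for u
    using N by (simp add: power_divide power3_eq_cube)
  have x3: "integrable M (\<lambda>\<omega>. \<bar>\<xi> r t (\<lambda>q. Z q \<omega>)\<bar>^3)"
    "(\<integral>\<omega>. \<bar>\<xi> r t (\<lambda>q. Z q \<omega>)\<bar>^3 \<partial>M) \<le> (1 + 3 * (\<Sum>i\<in>UNIV. (a t i)\<^sup>2)\<^sup>2) / (N * sqrt N)" for r t
    using std_normals_linear_form_cube[OF Zl finite, of "a t" r]
    unfolding \<xi>_def scale cube by (auto intro!: divide_right_mono)
  have y3: "integrable M (\<lambda>\<omega>. \<bar>\<eta> r t (\<lambda>q. Z q \<omega>)\<bar>^3)"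
    "(\<integral>\<omega>. \<bar>\<eta> r t (\<lambda>q. Z q \<omega>)\<bar>^3 \<partial>M) \<le> (1 + 3 * (\<Sum>i\<in>UNIV. (b t i)\<^sup>2)\<^sup>2) / (N * sqrt N)" for r t
    using std_normals_linear_form_cube[OF Zr finite, of "b t" r]
    unfolding \<eta>_def scale cube by (auto intro!: divide_right_mono)
  have \<xi>m: "\<xi> r t \<in> borel_measurable (PiM B (\<lambda>_. borel))" if "\<And>q. (r, q) \<in> B" for r t B
    unfolding \<xi>_def using that by (intro borel_measurable_sum borel_measurable_times
        measurable_component_singleton) auto
  have \<eta>m: "\<eta> r t \<in> borel_measurable (PiM B (\<lambda>_. borel))" if "\<And>q. (r, q) \<in> B" for r t B
    unfolding \<eta>_def using that by (intro borel_measurable_sum borel_measurable_times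
        measurable_component_singleton) auto
  have \<xi>r: "\<xi> r t (restrict f B) = \<xi> r t f" and \<eta>r: "\<eta> r t (restrict f B) = \<eta> r t f"
    if "\<And>q. (r, q) \<in> B" for r t f B
    using that by (simp_all add: \<xi>_def \<eta>_def)
  have step: "A (Suc l) \<le> A l + K / (N * sqrt N)" if "l < N" for l
  proof -
    \<comment> \<open>The part shared by the hybrids \<open>l\<close> and \<open>Suc l\<close>. It
      involves only variables whose first index differs from \<open>l\<close>, hence is independent
      of the copy being swapped.\<close>
    define \<zeta> where "\<zeta> t f = (\<Sum>r\<in>{..<N} - {l}. (if r < l then \<xi> else \<eta>) r t f)" for t f
    have split: "(\<Sum>r<N. (if r < Suc l then \<xi> else \<eta>) r t f) = \<zeta> t f + \<xi> l t f"
      "(\<Sum>r<N. (if r < l then \<xi> else \<eta>) r t f) = \<zeta> t f + \<eta> l t f" for t f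
      using that unfolding \<zeta>_def by (auto simp: sum.remove[of "{..<N}" l] less_Suc_eq intro!: sum.cong)
    let ?A = "(- {l}) \<times> (UNIV :: ('i + 'j) set)"
    let ?B = "{l} \<times> (UNIV :: ('i + 'j) set)"
    have ind: "indep_var (PiM (?A) (\<lambda>_. borel)) (\<lambda>\<omega>. \<lambda>q\<in>?A. Z q \<omega>) (PiM ?B (\<lambda>_. borel)) (\<lambda>\<omega>. \<lambda>q\<in>?B. Z q \<omega>)"
      using Z by (intro indep_var_restrict[of "\<lambda>_. borel" Z UNIV]) (auto simp: std_normals_def)
    have m: "(\<lambda>f. \<lambda>t\<in>T. \<zeta> t f) \<in> measurable (PiM (?A) (\<lambda>_. borel)) (PiM T (\<lambda>_. borel))"
      "(\<lambda>f. \<lambda>t\<in>T. \<xi> l t f) \<in> measurable (PiM ?B (\<lambda>_. borel)) (PiM T (\<lambda>_. borel))"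
      "(\<lambda>f. \<lambda>t\<in>T. \<eta> l t f) \<in> measurable (PiM ?B (\<lambda>_. borel)) (PiM T (\<lambda>_. borel))"
      using \<xi>m \<eta>m unfolding \<zeta>_def
      by (intro measurable_restrict borel_measurable_sum; auto)+
    have r: "\<zeta> t (restrict f (?A)) = \<zeta> t f" "\<xi> l t (restrict f ?B) = \<xi> l t f"
      "\<eta> l t (restrict f ?B) = \<eta> l t f" for t f
    proof -
      have "(if r < l then \<xi> else \<eta>) r t (restrict f (?A)) = (if r < l then \<xi> else \<eta>) r t f" if "r \<noteq> l" for r
        using that by (cases "r < l") (simp_all add: \<xi>r \<eta>r)
      then show "\<zeta> t (restrict f (?A)) = \<zeta> t f"
        unfolding \<zeta>_def by (intro sum.cong) auto
    qed (simp_all add: \<xi>r \<eta>r)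
    have ix: "indep_var (PiM T (\<lambda>_. borel)) (\<lambda>\<omega>. \<lambda>t\<in>T. \<zeta> t (\<lambda>q. Z q \<omega>))
        (PiM T (\<lambda>_. borel)) (\<lambda>\<omega>. \<lambda>t\<in>T. \<xi> l t (\<lambda>q. Z q \<omega>))"
      using indep_var_compose[OF ind m(1,2)] by (simp add: o_def r)
    have iy: "indep_var (PiM T (\<lambda>_. borel)) (\<lambda>\<omega>. \<lambda>t\<in>T. \<zeta> t (\<lambda>q. Z q \<omega>))
        (PiM T (\<lambda>_. borel)) (\<lambda>\<omega>. \<lambda>t\<in>T. \<eta> l t (\<lambda>q. Z q \<omega>))"
      using indep_var_compose[OF ind m(1,3)] by (simp add: o_def r)
    have z: "integrable M (\<lambda>\<omega>. \<zeta> t (\<lambda>q. Z q \<omega>))" for t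
      unfolding \<zeta>_def using x1 y1
      by (intro Bochner_Integration.integrable_sum) (auto simp: has_bochner_integral_iff)
    have "A (Suc l) \<le> A l + (\<Sum>t\<in>T. (\<integral>\<omega>. \<bar>\<xi> l t (\<lambda>q. Z q \<omega>)\<bar>^3 \<partial>M) + (\<integral>\<omega>. \<bar>\<eta> l t (\<lambda>q. Z q \<omega>)\<bar>^3 \<partial>M))"
      unfolding A_def split using le
      by (intro expectation_lse_add_mono[OF prob_space_axioms T ix iy z x1 x2 x3(1) y1 y2 y3(1)])
        (auto intro!: divide_right_mono)
    also have "(\<Sum>t\<in>T. (\<integral>\<omega>. \<bar>\<xi> l t (\<lambda>q. Z q \<omega>)\<bar>^3 \<partial>M) + (\<integral>\<omega>. \<bar>\<eta> l t (\<lambda>q. Z q \<omega>)\<bar>^3 \<partial>M))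
        \<le> (\<Sum>t\<in>T. (1 + 3 * (\<Sum>i\<in>UNIV. (a t i)\<^sup>2)\<^sup>2) / (N * sqrt N)
          + (1 + 3 * (\<Sum>i\<in>UNIV. (b t i)\<^sup>2)\<^sup>2) / (N * sqrt N))"
      by (intro sum_mono add_mono x3 y3)
    also have "\<dots> = K / (N * sqrt N)"
      unfolding K_def sum_divide_distrib by (intro sum.cong refl) (simp add: add_divide_distrib)
    finally show ?thesis by simp
  qed
  \<comment> \<open>The swaps telescope; at \<open>l = N\<close> the total cost is
    \<open>K / sqrt N\<close>.\<close>
  have "A l \<le> A 0 + l * (K / (N * sqrt N))" if "l \<le> N" for l
    using that
  proof (induction l)
    case (Suc l)
    then have "A (Suc l) \<le> A 0 + l * (K / (N * sqrt N)) + K / (N * sqrt N)"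
      using step[of l] by simp
    then show ?case by (simp add: algebra_simps add_divide_distrib)
  qed simp
  from this[of N] show ?thesis
    using N by (simp add: A_def)
qed

text \<open>The Sudakov--Fernique inequality for a smooth maximum. Both families are realised as
  block averages on one space, with \<open>Inl\<close> and \<open>Inr\<close> keeping their indices
  apart. The exchange error vanishes as the number of copies grows.\<close>

lemma gaussian_comparison_lse:
  fixes X :: "'i::finite \<Rightarrow> 'a \<Rightarrow> real" and V :: "'j::finite \<Rightarrow> 'b \<Rightarrow> real"
    and a :: "'t \<Rightarrow> 'i \<Rightarrow> real" and b :: "'t \<Rightarrow> 'j \<Rightarrow> real"
  assumes X: "std_normals M X UNIV" and V: "std_normals M' V UNIV" and T: "finite T" "T \<noteq> {}"
    and le: "\<And>s t. s \<in> T \<Longrightarrow> t \<in> T \<Longrightarrow>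
      (\<Sum>i\<in>UNIV. (a s i - a t i)\<^sup>2) \<le> (\<Sum>j\<in>UNIV. (b s j - b t j)\<^sup>2)"
  shows "(\<integral>\<omega>. lse T (\<lambda>t. \<Sum>i\<in>UNIV. a t i * X i \<omega>) \<partial>M)
    \<le> (\<integral>\<omega>. lse T (\<lambda>t. \<Sum>j\<in>UNIV. b t j * V j \<omega>) \<partial>M')"
proof -
  obtain P :: "(nat \<times> ('i + 'j) \<Rightarrow> real) measure" and Z :: "nat \<times> ('i + 'j) \<Rightarrow> _"
    where Z: "std_normals P Z UNIV"
    using std_normals_exist by blast
  \<comment> \<open>A Gaussian family on any space can be replaced by normalised sums of the common
    variables \<open>Z\<close>, for every positive number of copies.\<close>
  have law: "(\<integral>\<omega>. lse T (\<lambda>t. \<Sum>i\<in>UNIV. c t i * Y i \<omega>) \<partial>Q)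
      = (\<integral>\<omega>. lse T (\<lambda>t. \<Sum>r<N. \<Sum>i\<in>UNIV. c t i / sqrt N * Z (r, e i) \<omega>) \<partial>P)"
    if Y: "std_normals Q Y UNIV" and e: "inj e" and N: "N > 0"
    for Q :: "'q measure" and Y and c :: "'t \<Rightarrow> 'l::finite \<Rightarrow> real" and e and N :: nat
  proof -
    have m: "(\<lambda>f. lse T (\<lambda>t. \<Sum>i\<in>UNIV. c t i * f i)) \<in> borel_measurable (PiM UNIV (\<lambda>_. borel))"
      by (intro borel_measurable_lse T borel_measurable_sum borel_measurable_times
          measurable_component_singleton) auto
    have "(\<Sum>i\<in>UNIV. c t i * (\<Sum>r<N. Z (r, e i) \<omega> / sqrt N))
        = (\<Sum>r<N. \<Sum>i\<in>UNIV. c t i / sqrt N * Z (r, e i) \<omega>)" for t \<omega>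
      by (subst sum.swap) (simp add: sum_distrib_left)
    then show ?thesis
      using std_normals_same_law[OF Y std_normals_block_average[OF Z e N] UNIV_not_empty m] by simp
  qed
  define K where "K = (\<Sum>t\<in>T. 2 + 3 * (\<Sum>i\<in>UNIV. (a t i)\<^sup>2)\<^sup>2 + 3 * (\<Sum>j\<in>UNIV. (b t j)\<^sup>2)\<^sup>2)"
  let ?l = "\<integral>\<omega>. lse T (\<lambda>t. \<Sum>i\<in>UNIV. a t i * X i \<omega>) \<partial>M"
  let ?r = "\<integral>\<omega>. lse T (\<lambda>t. \<Sum>j\<in>UNIV. b t j * V j \<omega>) \<partial>M'"
  have "?l \<le> ?r + K / sqrt (Suc n)" for n
    using lindeberg_exchange[OF Z T _ le, of "Suc n"]
      law[OF X, of Inl "Suc n"] law[OF V, of Inr "Suc n"]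
    unfolding K_def by (simp add: inj_def)
  moreover have "(\<lambda>n. ?r + K / sqrt (Suc n)) \<longlonglongrightarrow> ?r + 0"
    by (intro tendsto_intros real_tendsto_divide_at_top[where c=K] filterlim_compose[OF sqrt_at_top]
        filterlim_compose[OF filterlim_real_sequentially] filterlim_Suc)
  ultimately show ?thesis
    using LIMSEQ_le_const[of "\<lambda>n. ?r + K / sqrt (Suc n)" "?r + 0" ?l] by auto
qed

section \<open>The comparison process for the norm of a Gaussian matrix\<close>

lemma std_gaussian_matrix_std_normals:
  assumes "prob_space M" "std_gaussian_matrix M X"
  shows "std_normals M (\<lambda>(i, j) \<omega>. X \<omega> $ i $ j) UNIV"
  using assms by (auto simp: std_gaussian_matrix_def std_normals_def)

lemma inner_matrix_vector_mult_pair_sum: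
  fixes A :: "real^'s^'r"
  shows "v \<bullet> (A *v u) = (\<Sum>(i, j)\<in>UNIV. (v $ i * u $ j) * A $ i $ j)"
  by (simp add: inner_vec_def matrix_vector_mult_def sum_distrib_left
      sum.cartesian_product[symmetric] UNIV_Times_UNIV[symmetric] algebra_simps
      del: UNIV_Times_UNIV)

text \<open>With \<open>p = u \<bullet> u'\<close> and \<open>q = v \<bullet> v'\<close>, the right
  side minus the left side is \<open>2 * (1 - p) * (1 - q)\<close>, which is nonnegative by
  Cauchy--Schwarz.\<close>

lemma tensor_increment_le:
  fixes u u' :: "real^'k" and v v' :: "real^'m"
  assumes "norm u = 1" "norm u' = 1" "norm v = 1" "norm v' = 1"
  shows "(\<Sum>(i, j)\<in>UNIV. (v $ i * u $ j - v' $ i * u' $ j)\<^sup>2) \<le> (norm (u - u'))\<^sup>2 + (norm (v - v'))\<^sup>2"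
proof -
  define p where "p = u \<bullet> u'"
  define q where "q = v \<bullet> v'"
  have "\<bar>p\<bar> \<le> 1" "\<bar>q\<bar> \<le> 1"
    using Cauchy_Schwarz_ineq2[of u u'] Cauchy_Schwarz_ineq2[of v v'] assms
    by (simp_all add: p_def q_def)
  then have "0 \<le> (1 - p) * (1 - q)" by (intro mult_nonneg_nonneg) auto
  moreover have "(\<Sum>(i, j)\<in>UNIV. (v $ i * u $ j - v' $ i * u' $ j)\<^sup>2)
      = (\<Sum>i\<in>UNIV. \<Sum>j\<in>UNIV. (v $ i * v $ i) * (u $ j * u $ j))
        + (\<Sum>i\<in>UNIV. \<Sum>j\<in>UNIV. (v' $ i * v' $ i) * (u' $ j * u' $ j))
        - 2 * (\<Sum>i\<in>UNIV. \<Sum>j\<in>UNIV. (v $ i * v' $ i) * (u $ j * u' $ j))"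
    unfolding UNIV_Times_UNIV[symmetric] sum.cartesian_product[symmetric]
      sum_distrib_left[of 2] sum.distrib[symmetric] sum_subtractf[symmetric]
    by (intro sum.cong refl) (simp add: power2_eq_square algebra_simps)
  moreover have "\<dots> = (v \<bullet> v) * (u \<bullet> u) + (v' \<bullet> v') * (u' \<bullet> u') - 2 * (q * p)"
    by (simp add: inner_vec_def p_def q_def sum_product)
  moreover have "w \<bullet> w = 1" if "norm w = 1" for w :: "'x::real_inner"
    using that by (simp add: norm_eq_1)
  moreover have "(norm (u - u'))\<^sup>2 = u \<bullet> u + u' \<bullet> u' - 2 * p"
    "(norm (v - v'))\<^sup>2 = v \<bullet> v + v' \<bullet> v' - 2 * q"
    by (simp_all add: power2_norm_eq_inner p_def q_def algebra_simps inner_commute)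
  ultimately show ?thesis using assms by (simp add: norm_eq_1 algebra_simps)
qed

lemma sum_UNIV_sum_type:
  "(\<Sum>x\<in>UNIV. f x) = (\<Sum>i\<in>UNIV. f (Inl i)) + (\<Sum>j\<in>UNIV. f (Inr j))"
  for f :: "'i::finite + 'j::finite \<Rightarrow> 'c::comm_monoid_add"
proof -
  have "(UNIV :: ('i + 'j) set) = range Inl \<union> range Inr"
    using UNIV_Plus_UNIV unfolding Plus_def by blast
  moreover have "sum f (range Inl \<union> range Inr) = sum f (range Inl) + sum f (range Inr)"
    by (intro sum.union_disjoint) auto
  ultimately show ?thesis by (simp add: sum.reindex)
qed

text \<open>The bound \<open>x \<le> (x\<^sup>2 / c + c) / 2\<close> replaces Cauchy--Schwarz for the expected norm.\<close>

lemma chevet_finite_lse: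
  fixes X :: "'a \<Rightarrow> real^'k^'m"
  assumes M: "prob_space M" and X: "std_gaussian_matrix M X"
    and T: "finite T" "T \<noteq> {}" "\<And>u v. (u, v) \<in> T \<Longrightarrow> norm u = 1 \<and> norm v = 1" and \<beta>: "\<beta> > 0"
  shows "(\<integral>\<omega>. lse T (\<lambda>(u, v). \<beta> * (v \<bullet> (X \<omega> *v u))) \<partial>M)
    \<le> \<beta> * (sqrt CARD('k) + sqrt CARD('m)) + ln (card T)"
proof -
  obtain P :: "('k + 'm \<Rightarrow> real) measure" and V :: "'k + 'm \<Rightarrow> _" where V: "std_normals P V UNIV"
    using std_normals_exist by blast
  interpret P: prob_space P using V by (simp add: std_normals_def)
  \<comment> \<open>Coefficients of the two processes, both scaled by \<open>\<beta>\<close>: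
    \<open>a\<close> gives \<open>v \<bullet> (X *v u)\<close> and \<open>b\<close> gives
    \<open>u \<bullet> g + v \<bullet> h\<close>.\<close>
  define a where "a t = (\<lambda>(i, j). \<beta> * (snd t $ i * fst t $ j))" for t :: "(real^'k) \<times> (real^'m)"
  define b where "b t = case_sum (\<lambda>j. \<beta> * fst t $ j) (\<lambda>i. \<beta> * snd t $ i)" for t :: "(real^'k) \<times> (real^'m)"
  define g where "g \<omega> = (\<chi> j. V (Inl j) \<omega>)" for \<omega>
  define h where "h \<omega> = (\<chi> i. V (Inr i) \<omega>)" for \<omega>
  define B where "B c n = (n\<^sup>2 / c + c) / 2" for c n :: real
  have B: "n \<le> B c n" if "c > 0" for c n
  proof -
    have "0 \<le> (n - c)\<^sup>2" by simp
    then show ?thesis using that by (simp add: B_def field_simps power2_eq_square)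
  qed
  have V2: "has_bochner_integral P (\<lambda>\<omega>. (V j \<omega>)\<^sup>2) 1" for j
    using std_normals_linear_form_moments(2)[OF V finite, of "\<lambda>i. if i = j then 1 else 0"]
    by (simp add: if_distrib[of "\<lambda>x. x * _"] if_distrib[of "\<lambda>x. x\<^sup>2"] cong: if_cong)
  have g: "has_bochner_integral P (\<lambda>\<omega>. (norm (g \<omega>))\<^sup>2) CARD('k)"
    using has_bochner_integral_sum[of UNIV P "\<lambda>j \<omega>. (V (Inl j) \<omega>)\<^sup>2" "\<lambda>_. 1", OF V2]
    by (simp add: power2_norm_eq_inner inner_vec_def g_def flip: power2_eq_square)
  have h: "has_bochner_integral P (\<lambda>\<omega>. (norm (h \<omega>))\<^sup>2) CARD('m)"
    using has_bochner_integral_sum[of UNIV P "\<lambda>j \<omega>. (V (Inr j) \<omega>)\<^sup>2" "\<lambda>_. 1", OF V2]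
    by (simp add: power2_norm_eq_inner inner_vec_def h_def flip: power2_eq_square)
  \<comment> \<open>For a variable with mean square \<open>n\<close>, the choice
    \<open>c = sqrt n\<close> balances the two summands of \<open>B\<close> and gives the mean
    \<open>sqrt n\<close> exactly.\<close>
  have B_integral: "has_bochner_integral P (\<lambda>\<omega>. B (sqrt n) (f \<omega>)) (sqrt n)"
    if "has_bochner_integral P (\<lambda>\<omega>. (f \<omega>)\<^sup>2) n" "n > 0" for f and n :: real
  proof -
    have "integrable P (\<lambda>\<omega>. (f \<omega>)\<^sup>2)" "(\<integral>\<omega>. (f \<omega>)\<^sup>2 \<partial>P) = n"
      using that by (auto simp: has_bochner_integral_iff)
    then show ?thesis
      using that(2) by (simp add: has_bochner_integral_iff B_def P.prob_space real_div_sqrt)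
  qed
  have bound: "has_bochner_integral P
      (\<lambda>\<omega>. \<beta> * (B (sqrt CARD('k)) (norm (g \<omega>)) + B (sqrt CARD('m)) (norm (h \<omega>))) + ln (card T))
      (\<beta> * (sqrt CARD('k) + sqrt CARD('m)) + ln (card T))"
    using B_integral[OF g] B_integral[OF h]
    by (simp add: has_bochner_integral_iff P.prob_space)
  have le: "(\<Sum>i\<in>UNIV. (a s i - a t i)\<^sup>2) \<le> (\<Sum>j\<in>UNIV. (b s j - b t j)\<^sup>2)" if "s \<in> T" "t \<in> T" for s t
  proof -
    obtain u v u' v' where st: "s = (u, v)" "t = (u', v')" by (metis surj_pair)
    have "(\<Sum>i\<in>UNIV. (a s i - a t i)\<^sup>2) = \<beta>\<^sup>2 * (\<Sum>(i, j)\<in>UNIV. (v $ i * u $ j - v' $ i * u' $ j)\<^sup>2)"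
      unfolding sum_distrib_left a_def st
      by (intro sum.cong refl) (auto simp: power2_eq_square algebra_simps)
    also have "\<dots> \<le> \<beta>\<^sup>2 * ((norm (u - u'))\<^sup>2 + (norm (v - v'))\<^sup>2)"
      using T(3) that unfolding st by (intro mult_left_mono tensor_increment_le) auto
    also have "\<dots> = (\<Sum>j\<in>UNIV. (b s j - b t j)\<^sup>2)"
      unfolding sum_UNIV_sum_type b_def st power2_norm_eq_inner inner_vec_def distrib_left sum_distrib_left
      by (intro arg_cong2[where f="(+)"] sum.cong refl) (auto simp: power2_eq_square algebra_simps)
    finally show ?thesis .
  qed
  have "(\<integral>\<omega>. lse T (\<lambda>(u, v). \<beta> * (v \<bullet> (X \<omega> *v u))) \<partial>M)
      = (\<integral>\<omega>. lse T (\<lambda>t. \<Sum>i\<in>UNIV. a t i * (case i of (i, j) \<Rightarrow> \<lambda>\<omega>. X \<omega> $ i $ j) \<omega>) \<partial>M)"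
    by (simp add: inner_matrix_vector_mult_pair_sum a_def sum_distrib_left case_prod_unfold mult.assoc)
  also have "\<dots> \<le> (\<integral>\<omega>. lse T (\<lambda>t. \<Sum>j\<in>UNIV. b t j * V j \<omega>) \<partial>P)"
    by (rule gaussian_comparison_lse[OF std_gaussian_matrix_std_normals[OF M X] V T(1,2) le])
  also have "\<dots> \<le> (\<integral>\<omega>. \<beta> * (B (sqrt CARD('k)) (norm (g \<omega>)) + B (sqrt CARD('m)) (norm (h \<omega>))) + ln (card T) \<partial>P)"
  proof (rule integral_mono)
    have "integrable P (V j)" for j
      using std_normals_linear_form_moments(1)[OF V finite, of "\<lambda>i. if i = j then 1 else 0"]
      by (simp add: has_bochner_integral_iff if_distrib[of "\<lambda>x. x * _"] cong: if_cong)
    then show "integrable P (\<lambda>\<omega>. lse T (\<lambda>t. \<Sum>j\<in>UNIV. b t j * V j \<omega>))"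
      by (intro integrable_lse P.prob_space_axioms T Bochner_Integration.integrable_sum) auto
    show "lse T (\<lambda>t. \<Sum>j\<in>UNIV. b t j * V j \<omega>)
        \<le> \<beta> * (B (sqrt CARD('k)) (norm (g \<omega>)) + B (sqrt CARD('m)) (norm (h \<omega>))) + ln (card T)" for \<omega>
    proof (rule lse_le[OF T(1,2)])
      fix t assume t: "t \<in> T"
      obtain u v where uv: "t = (u, v)" by (metis surj_pair)
      have "(\<Sum>j\<in>UNIV. b t j * V j \<omega>) = \<beta> * (u \<bullet> g \<omega> + v \<bullet> h \<omega>)"
        by (simp add: sum_UNIV_sum_type b_def uv g_def h_def inner_vec_def distrib_left sum_distrib_left mult.assoc)
      also have "\<dots> \<le> \<beta> * (norm (g \<omega>) + norm (h \<omega>))"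
        using norm_cauchy_schwarz[of u "g \<omega>"] norm_cauchy_schwarz[of v "h \<omega>"] T(3) t \<beta> uv
        by (intro mult_left_mono add_mono) auto
      also have "\<dots> \<le> \<beta> * (B (sqrt CARD('k)) (norm (g \<omega>)) + B (sqrt CARD('m)) (norm (h \<omega>)))"
        using \<beta> by (intro mult_left_mono add_mono B) auto
      finally show "(\<Sum>j\<in>UNIV. b t j * V j \<omega>)
        \<le> \<beta> * (B (sqrt CARD('k)) (norm (g \<omega>)) + B (sqrt CARD('m)) (norm (h \<omega>)))" .
    qed
  next
    show "integrable P (\<lambda>\<omega>. \<beta> * (B (sqrt CARD('k)) (norm (g \<omega>)) + B (sqrt CARD('m)) (norm (h \<omega>))) + ln (card T))"
      by (rule integrable.intros[OF bound])
  qed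
  also have "\<dots> = \<beta> * (sqrt CARD('k) + sqrt CARD('m)) + ln (card T)"
    by (rule has_bochner_integral_integral_eq[OF bound])
  finally show ?thesis .
qed

section \<open>Chevet's inequality\<close>

lemma spectral_norm_bound: "norm (A *v x) \<le> spectral_norm A * norm x"
  unfolding spectral_norm_def by (rule onorm[OF matrix_vector_mul_bounded_linear])

lemma spectral_norm_le:
  assumes "\<And>x. norm (A *v x) \<le> b * norm x"
  shows "spectral_norm A \<le> b"
  unfolding spectral_norm_def by (rule onorm_le) (rule assms)

lemma spectral_norm_nonneg: "0 \<le> spectral_norm A"
  unfolding spectral_norm_def by (rule onorm_pos_le[OF matrix_vector_mul_bounded_linear])

text \<open>The bilinear form is tested at the normalisations of \<open>x\<close> and of
  \<open>A *v x\<close>, where it equals \<open>norm (A *v x) / norm x\<close>.\<close>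

lemma spectral_norm_le_bilinear:
  assumes y: "\<And>u v. norm u = 1 \<Longrightarrow> norm v = 1 \<Longrightarrow> v \<bullet> (A *v u) \<le> y"
  shows "spectral_norm (A :: real^'s^'r) \<le> y"
proof (rule spectral_norm_le)
  fix x :: "real^'s"
  show "norm (A *v x) \<le> y * norm x"
  proof (cases "x = 0 \<or> A *v x = 0")
    case True
    obtain e :: "real^'r" and f :: "real^'s" where ef: "norm e = 1" "norm f = 1"
      using vector_choose_size[of 1] by (metis zero_le_one)
    \<comment> \<open>The degenerate case needs \<open>y\<close> nonnegative, which follows by
      testing with a unit vector and its negative.\<close>
    have "0 \<le> y" using y[OF ef(2,1)] y[of f "- e"] ef by simp
    with True show ?thesis by auto
  next
    case False
    define u where "u = x /\<^sub>R norm x"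
    define v where "v = (A *v x) /\<^sub>R norm (A *v x)"
    have "v \<bullet> (A *v u) \<le> y" using False by (intro y) (auto simp: u_def v_def)
    moreover have "v \<bullet> (A *v u) = norm (A *v x) / norm x"
      using False by (simp add: u_def v_def matrix_vector_mult_scaleR power2_norm_eq_inner[symmetric]
          power2_eq_square field_simps)
    ultimately show ?thesis using False by (simp add: field_simps)
  qed
qed

text \<open>Scaling by \<open>Suc n\<close> and dividing the result by \<open>Suc n\<close> reduces
  the log-sum-exp error to \<open>ln (card T) / Suc n\<close>, which tends to zero. The symmetry of
  \<open>T\<close> makes the maximum nonnegative, so that \<open>ennreal\<close> does not truncate
  it.\<close>

lemma chevet_finite:
  fixes X :: "'a \<Rightarrow> real^'k^'m"
  assumes M: "prob_space M" and X: "std_gaussian_matrix M X"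
    and T: "finite T" "T \<noteq> {}" "\<And>u v. (u, v) \<in> T \<Longrightarrow> norm u = 1 \<and> norm v = 1"
    and sym: "\<And>u v. (u, v) \<in> T \<Longrightarrow> (u, - v) \<in> T"
  shows "(\<integral>\<^sup>+\<omega>. (SUP (u, v)\<in>T. ennreal (v \<bullet> (X \<omega> *v u))) \<partial>M) \<le> ennreal (sqrt CARD('k) + sqrt CARD('m))"
proof -
  interpret prob_space M by fact
  define F where "F \<omega> = Max ((\<lambda>(u, v). v \<bullet> (X \<omega> *v u)) ` T)" for \<omega>
  let ?c = "sqrt CARD('k) + sqrt CARD('m)"
  have Xm: "(\<lambda>\<omega>. X \<omega> $ i $ j) \<in> borel_measurable M" for i j
    using std_normals_measurable[OF std_gaussian_matrix_std_normals[OF M X], of "(i, j)"] by simp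
  have fm: "(\<lambda>\<omega>. v \<bullet> (X \<omega> *v u)) \<in> borel_measurable M" for u v
    unfolding inner_vec_def matrix_vector_mult_def using Xm by simp
  have fi: "integrable M (\<lambda>\<omega>. v \<bullet> (X \<omega> *v u))" for u v
    using std_normals_linear_form_moments(1)[OF std_gaussian_matrix_std_normals[OF M X] finite,
        of "\<lambda>(i, j). v $ i * u $ j"]
    by (simp add: has_bochner_integral_iff inner_matrix_vector_mult_pair_sum case_prod_unfold)
  have Fm: "F \<in> borel_measurable M"
    unfolding F_def using T fm by (intro borel_measurable_Max) (auto simp: case_prod_unfold)
  have Fge: "v \<bullet> (X \<omega> *v u) \<le> F \<omega>" if "(u, v) \<in> T" for u v \<omega>
    unfolding F_def using T that by (intro Max_ge) (auto intro: image_eqI[of _ _ "(u, v)"])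
  have F0: "0 \<le> F \<omega>" for \<omega>
  proof -
    obtain u v where uv: "(u, v) \<in> T" using T(2) by auto
    have "v \<bullet> (X \<omega> *v u) \<le> F \<omega>" "- (v \<bullet> (X \<omega> *v u)) \<le> F \<omega>"
      using Fge[OF uv, of \<omega>] Fge[OF sym[OF uv], of \<omega>] by auto
    then show ?thesis by linarith
  qed
  have Fle: "F \<omega> \<le> (\<Sum>(u, v)\<in>T. \<bar>v \<bullet> (X \<omega> *v u)\<bar>)" for \<omega>
    unfolding F_def using T
    by (subst Max_le_iff) (auto intro!: order_trans[OF abs_ge_self member_le_sum[where f="\<lambda>(u, v). \<bar>v \<bullet> (X \<omega> *v u)\<bar>", of "(_, _)", simplified]])
  have Fi: "integrable M F"
  proof (rule Bochner_Integration.integrable_bound[OF _ Fm])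
    show "integrable M (\<lambda>\<omega>. \<Sum>(u, v)\<in>T. \<bar>v \<bullet> (X \<omega> *v u)\<bar>)"
      using fi by (auto simp: case_prod_unfold)
    show "AE \<omega> in M. norm (F \<omega>) \<le> norm (\<Sum>(u, v)\<in>T. \<bar>v \<bullet> (X \<omega> *v u)\<bar>)"
      using F0 Fle order_trans[OF F0 Fle] by simp
  qed
  have le: "(\<integral>\<omega>. F \<omega> \<partial>M) \<le> ?c + ln (card T) / Suc n" for n
  proof -
    have "Suc n * (\<integral>\<omega>. F \<omega> \<partial>M) = (\<integral>\<omega>. Suc n * F \<omega> \<partial>M)" by simp
    also have "\<dots> \<le> (\<integral>\<omega>. lse T (\<lambda>(u, v). Suc n * (v \<bullet> (X \<omega> *v u))) \<partial>M)"
    proof (rule integral_mono)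
      show "integrable M (\<lambda>\<omega>. lse T (\<lambda>(u, v). Suc n * (v \<bullet> (X \<omega> *v u))))"
        using integrable_lse[OF M T(1,2), of "\<lambda>(u, v) \<omega>. Suc n * (v \<bullet> (X \<omega> *v u))"] fi
        by (simp add: case_prod_unfold)
      fix \<omega>
      have "F \<omega> \<in> (\<lambda>(u, v). v \<bullet> (X \<omega> *v u)) ` T"
        unfolding F_def using T by (intro Max_in) auto
      then obtain u v where "(u, v) \<in> T" "F \<omega> = v \<bullet> (X \<omega> *v u)" by auto
      then show "Suc n * F \<omega> \<le> lse T (\<lambda>(u, v). Suc n * (v \<bullet> (X \<omega> *v u)))"
        using lse_ge[OF T(1), of "(u, v)" "\<lambda>(u, v). Suc n * (v \<bullet> (X \<omega> *v u))"] by simp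
    qed (use Fi in simp)
    also have "\<dots> \<le> Suc n * ?c + ln (card T)"
      by (rule chevet_finite_lse[OF M X T]) auto
    finally show ?thesis by (simp add: field_simps)
  qed
  have "(\<lambda>n. ?c + ln (card T) / Suc n) \<longlonglongrightarrow> ?c + 0"
    by (intro tendsto_intros LIMSEQ_Suc[OF lim_const_over_n])
  then have EF: "(\<integral>\<omega>. F \<omega> \<partial>M) \<le> ?c"
    using LIMSEQ_le_const[of "\<lambda>n. ?c + ln (card T) / Suc n" "?c + 0"] le by auto
  have "(\<integral>\<^sup>+\<omega>. (SUP (u, v)\<in>T. ennreal (v \<bullet> (X \<omega> *v u))) \<partial>M) \<le> (\<integral>\<^sup>+\<omega>. ennreal (F \<omega>) \<partial>M)"
    using Fge by (intro nn_integral_mono SUP_least) (auto intro!: ennreal_leI)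
  also have "\<dots> = ennreal (\<integral>\<omega>. F \<omega> \<partial>M)"
    using Fi F0 by (intro nn_integral_eq_integral) auto
  also have "\<dots> \<le> ennreal ?c"
    using EF by (rule ennreal_leI)
  finally show ?thesis .
qed

text \<open>The norm is a supremum over dense sequences in the two spheres. Finite initial parts
  obey the bound uniformly, and monotone convergence passes to the limit.\<close>

theorem chevet:
  fixes X :: "'a \<Rightarrow> real^'k^'m"
  assumes M: "prob_space M" and X: "std_gaussian_matrix M X"
  shows "(\<integral>\<^sup>+\<omega>. ennreal (spectral_norm (X \<omega>)) \<partial>M) \<le> ennreal (sqrt CARD('k) + sqrt CARD('m))"
proof -
  obtain C where C: "countable C" "C \<subseteq> sphere 0 1" "sphere (0 :: real^'k) 1 \<subseteq> closure C"
    using separable by blast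
  obtain D where D: "countable D" "D \<subseteq> sphere 0 1" "sphere (0 :: real^'m) 1 \<subseteq> closure D"
    using separable by blast
  have "sphere (0 :: real^'k) 1 \<noteq> {}" "sphere (0 :: real^'m) 1 \<noteq> {}" by simp_all
  then have ne: "C \<noteq> {}" "D \<noteq> {}" using C D by auto
  define c where "c = from_nat_into C"
  define d where "d = from_nat_into D"
  have c: "range c = C" and d: "range d = D"
    using C D ne by (simp_all add: c_def d_def range_from_nat_into)
  \<comment> \<open>The negatives are adjoined to give the symmetry that
    \<open>chevet_finite\<close> asks for.\<close>
  define T where "T n = c ` {..n} \<times> (d ` {..n} \<union> uminus ` d ` {..n})" for n :: nat
  have T: "finite (T n)" "T n \<noteq> {}" for n by (auto simp: T_def)
  have T1: "norm u = 1 \<and> norm v = 1" if "(u, v) \<in> T n" for u v n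
  proof -
    have "norm (c i) = 1" "norm (d i) = 1" for i using C(2) D(2) c d by fastforce+
    then show ?thesis using that by (auto simp: T_def)
  qed
  have Tsym: "(u, - v) \<in> T n" if "(u, v) \<in> T n" for u v n
    using that by (auto simp: T_def)
  define F where "F n \<omega> = (SUP (u, v)\<in>T n. ennreal (v \<bullet> (X \<omega> *v u)))" for n \<omega>
  have Xm: "(\<lambda>\<omega>. X \<omega> $ i $ j) \<in> borel_measurable M" for i j
    using std_normals_measurable[OF std_gaussian_matrix_std_normals[OF M X], of "(i, j)"] by simp
  have fm: "(\<lambda>\<omega>. v \<bullet> (X \<omega> *v u)) \<in> borel_measurable M" for u v
    unfolding inner_vec_def matrix_vector_mult_def using Xm by simp
  have Fm: "F n \<in> borel_measurable M" for n
    unfolding F_def case_prod_unfold using T(1)[of n] fm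
    by (intro borel_measurable_SUP measurable_compose[OF fm measurable_ennreal]) (auto intro: countable_finite)
  have "ennreal (spectral_norm (X \<omega>)) \<le> (SUP n. F n \<omega>)" for \<omega>
  proof (cases "SUP n. F n \<omega>")
    case (real y)
    have "d j \<bullet> (X \<omega> *v c i) \<le> y" for i j
    proof -
      have "ennreal (d j \<bullet> (X \<omega> *v c i)) \<le> F (max i j) \<omega>"
        unfolding F_def by (rule SUP_upper2[of "(c i, d j)"]) (auto simp: T_def)
      also have "\<dots> \<le> ennreal y" unfolding real(2)[symmetric] by (rule SUP_upper) simp
      finally show ?thesis using real(1) by (simp add: ennreal_le_iff)
    qed
    then have CD: "v \<bullet> (X \<omega> *v u) \<le> y" if "u \<in> C" "v \<in> D" for u v
      using that c d by auto
    \<comment> \<open>The bound passes from dense sets to the spheres one variable at a time,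
      because a closed half-space that contains a set contains its closure.\<close>
    have CS: "v \<bullet> (X \<omega> *v u) \<le> y" if "u \<in> C" "norm v = 1" for u v
    proof -
      have "closure D \<subseteq> {v. (X \<omega> *v u) \<bullet> v \<le> y}"
        using CD[OF that(1)] by (intro closure_minimal closed_halfspace_le) (auto simp: inner_commute)
      then show ?thesis using D(3) that(2) by (auto simp: inner_commute)
    qed
    have "v \<bullet> (X \<omega> *v u) \<le> y" if "norm u = 1" "norm v = 1" for u v
    proof -
      have "closure C \<subseteq> {u. (v v* X \<omega>) \<bullet> u \<le> y}"
        using CS[OF _ that(2)] by (intro closure_minimal closed_halfspace_le) (auto simp: dot_lmul_matrix)
      then show ?thesis using C(3) that(1) by (auto simp: dot_lmul_matrix)
    qed
    then have "spectral_norm (X \<omega>) \<le> y" by (rule spectral_norm_le_bilinear)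
    then show ?thesis unfolding real(2) by (rule ennreal_leI)
  next
    case top
    show ?thesis unfolding top by (rule top_greatest)
  qed
  then have "(\<integral>\<^sup>+\<omega>. ennreal (spectral_norm (X \<omega>)) \<partial>M) \<le> (\<integral>\<^sup>+\<omega>. (SUP n. F n \<omega>) \<partial>M)"
    by (rule nn_integral_mono)
  also have "\<dots> = (SUP n. \<integral>\<^sup>+\<omega>. F n \<omega> \<partial>M)"
  proof (rule nn_integral_monotone_convergence_SUP)
    show "incseq F"
      unfolding F_def incseq_def le_fun_def by (intro allI impI SUP_subset_mono) (auto simp: T_def)
  qed (rule Fm)
  also have "\<dots> \<le> ennreal (sqrt CARD('k) + sqrt CARD('m))"
    unfolding F_def by (intro SUP_least chevet_finite[OF M X T T1 Tsym])
  finally show ?thesis .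
qed

section \<open>The distance of a Gaussian vector from a subspace\<close>

lemma bessel_inequality:
  fixes B :: "(real^'r) set"
  assumes "pairwise orthogonal B" "\<And>b. b \<in> B \<Longrightarrow> norm b = 1"
  shows "(\<Sum>b\<in>B. (b \<bullet> x)\<^sup>2) \<le> (norm x)\<^sup>2"
proof -
  have B: "orthonormal_basis B (span B)" using assms by (auto simp: orthonormal_basis_def)
  note fin = orthonormal_basis_finite[OF B]
  define q where "q = QQ_star B *v x"
  have "(x - q) \<bullet> q = 0"
    unfolding q_def by (intro QQ_star_projects(2)[OF B] QQ_star_projects(1)[OF B])
  moreover have "x \<bullet> q = (\<Sum>b\<in>B. (b \<bullet> x)\<^sup>2)"
    by (simp add: q_def QQ_star_mult[OF fin] inner_sum_right power2_eq_square inner_commute)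
  moreover have "0 \<le> (x - q) \<bullet> (x - q)" by simp
  ultimately show ?thesis
    by (simp add: power2_norm_eq_inner inner_diff_left inner_diff_right inner_commute)
qed

text \<open>The range of \<open>G\<close> has dimension at most \<open>CARD('p)\<close>, so its
  orthogonal complement has dimension at least \<open>d\<close>. An orthonormal basis of the
  complement is cut down to exactly \<open>d\<close> vectors, whatever the rank of
  \<open>G\<close>.\<close>

lemma orthonormal_subset_of_complement:
  fixes G :: "real^'p^'m"
  assumes d: "d + CARD('p) \<le> CARD('m)"
  obtains B where "card B = d" "finite B" "pairwise orthogonal B" "\<And>b. b \<in> B \<Longrightarrow> norm b = 1"
    "\<And>b y. b \<in> B \<Longrightarrow> b \<bullet> (G *v y) = 0"
proof -
  let ?R = "range (\<lambda>y. G *v y)"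
  let ?U = "{x \<in> UNIV. \<forall>y\<in>?R. orthogonal y x}"
  have lin: "linear (\<lambda>y. G *v y)" by (rule matrix_vector_mul_linear)
  have R: "subspace ?R" by (rule linear_subspace_image[OF lin subspace_UNIV])
  have U: "subspace ?U" using subspace_orthogonal_to_vectors[of ?R] by simp
  have "dim ?U + dim ?R = CARD('m)"
    using dim_subspace_orthogonal_to_vectors[OF R subspace_UNIV] by (simp add: dim_UNIV)
  moreover have "dim ?R \<le> CARD('p)"
    using dim_image_le[OF lin, of UNIV] by (simp add: dim_UNIV)
  ultimately have dU: "d \<le> dim ?U" using d by linarith
  obtain C where C: "C \<subseteq> ?U" "pairwise orthogonal C" "\<And>x. x \<in> C \<Longrightarrow> norm x = 1"
      "independent C" "card C = dim ?U" "span C = ?U"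
    by (rule orthonormal_basis_subspace[OF U]) (rule that; assumption)
  have "d \<le> card C" using dU C(5) by simp
  then obtain B where B: "B \<subseteq> C" "card B = d" "finite B"
    by (rule obtain_subset_with_card_n)
  show thesis
  proof (rule that[OF B(2,3)])
    show "pairwise orthogonal B" using C(2) B(1) by (rule pairwise_subset)
    show "norm b = 1" if "b \<in> B" for b using C(3) B(1) that by auto
    show "b \<bullet> (G *v y) = 0" if "b \<in> B" for b y
      using C(1) B(1) that by (auto simp: orthogonal_def inner_commute)
  qed
qed

lemma sum_tensor_square:
  fixes a :: "real^'k" and b :: "real^'m"
  shows "(\<Sum>ij\<in>UNIV. (case ij of (i, j) \<Rightarrow> b $ i * a $ j)\<^sup>2) = (norm b)\<^sup>2 * (norm a)\<^sup>2"
  unfolding power2_norm_eq_inner inner_vec_def sum_product UNIV_Times_UNIV[symmetric]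
    sum.cartesian_product by (intro sum.cong refl) (auto simp: power2_eq_square)

lemma gaussian_bilinear_moments:
  fixes X :: "'a \<Rightarrow> real^'k^'m"
  assumes M: "prob_space M" and X: "std_gaussian_matrix M X"
  shows "has_bochner_integral M (\<lambda>\<omega>. (b \<bullet> (X \<omega> *v a))\<^sup>2) ((norm b)\<^sup>2 * (norm a)\<^sup>2)"
    and "has_bochner_integral M (\<lambda>\<omega>. (b \<bullet> (X \<omega> *v a))^4) (3 * ((norm b)\<^sup>2 * (norm a)\<^sup>2)\<^sup>2)"
  using std_normals_linear_form_moments(2,3)[OF std_gaussian_matrix_std_normals[OF M X] finite,
      of "\<lambda>(i, j). b $ i * a $ j"]
  by (simp_all add: inner_matrix_vector_mult_pair_sum sum_tensor_square) (simp_all add: case_prod_unfold)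

text \<open>Polarisation: \<open>12 * x\<^sup>2 * y\<^sup>2 = (x + y)^4 + (x - y)^4 - 2 * x^4 - 2 *
  y^4\<close>. The mixed moment thus comes from fourth moments of single linear forms, without
  proving \<open>x\<close> and \<open>y\<close> independent.\<close>

lemma gaussian_bilinear_square_product:
  fixes X :: "'a \<Rightarrow> real^'k^'m"
  assumes M: "prob_space M" and X: "std_gaussian_matrix M X"
    and b: "norm b = 1" "norm b' = 1" "b \<bullet> b' = 0"
  shows "has_bochner_integral M (\<lambda>\<omega>. (b \<bullet> (X \<omega> *v a))\<^sup>2 * (b' \<bullet> (X \<omega> *v a))\<^sup>2) ((norm a)^4)"
proof -
  have n: "(norm (b + b'))\<^sup>2 = 2" "(norm (b - b'))\<^sup>2 = 2" "b \<bullet> b = 1" "b' \<bullet> b' = 1"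
    using b by (simp_all add: power2_norm_eq_inner norm_eq_1 inner_add_left inner_add_right
        inner_diff_left inner_diff_right inner_commute)
  define x y where "x = (\<lambda>\<omega>. b \<bullet> (X \<omega> *v a))" and "y = (\<lambda>\<omega>. b' \<bullet> (X \<omega> *v a))"
  note m = gaussian_bilinear_moments(2)[OF M X, of _ a]
  have "has_bochner_integral M (\<lambda>\<omega>. ((x \<omega> + y \<omega>)^4 + (x \<omega> - y \<omega>)^4 - 2 * (x \<omega>)^4 - 2 * (y \<omega>)^4) / 12)
      ((3 * (2 * (norm a)\<^sup>2)\<^sup>2 + 3 * (2 * (norm a)\<^sup>2)\<^sup>2 - 2 * (3 * (1 * (norm a)\<^sup>2)\<^sup>2) - 2 * (3 * (1 * (norm a)\<^sup>2)\<^sup>2)) / 12)"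
    using m[of "b + b'"] m[of "b - b'"] m[of b] m[of b'] n b
    unfolding x_def y_def
    by (simp add: has_bochner_integral_iff inner_add_left inner_diff_left)
  moreover have "((u + v)^4 + (u - v)^4 - 2 * u^4 - 2 * v^4) / 12 = u\<^sup>2 * v\<^sup>2" for u v :: real
    by (simp add: power4_eq_xxxx power2_eq_square algebra_simps)
  moreover have "(3 * (2 * u\<^sup>2)\<^sup>2 + 3 * (2 * u\<^sup>2)\<^sup>2 - 2 * (3 * (1 * u\<^sup>2)\<^sup>2) - 2 * (3 * (1 * u\<^sup>2)\<^sup>2)) / 12 = u^4" for u :: real
    by (simp add: power4_eq_xxxx power2_eq_square algebra_simps)
  ultimately show ?thesis unfolding x_def y_def by simp
qed

text \<open>Up to the factor \<open>(norm a)\<^sup>2\<close>, these are the first two moments of a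
  chi-squared variable with \<open>card B\<close> degrees of freedom. In the double sum for the
  second, diagonal pairs count 3 and all others 1.\<close>

lemma gaussian_projection_moments:
  fixes X :: "'a \<Rightarrow> real^'k^'m" and a :: "real^'k"
  assumes M: "prob_space M" and X: "std_gaussian_matrix M X"
    and B: "finite B" "pairwise orthogonal B" "\<And>b. b \<in> B \<Longrightarrow> norm b = 1"
  defines "q \<equiv> \<lambda>\<omega>. \<Sum>b\<in>B. (b \<bullet> (X \<omega> *v a))\<^sup>2"
  shows "has_bochner_integral M q (card B * (norm a)\<^sup>2)"
    and "has_bochner_integral M (\<lambda>\<omega>. (q \<omega>)\<^sup>2) (card B * (card B + 2) * (norm a)^4)"
proof -
  show "has_bochner_integral M q (card B * (norm a)\<^sup>2)"
  proof -
    have "has_bochner_integral M (\<lambda>\<omega>. (b \<bullet> (X \<omega> *v a))\<^sup>2) ((norm a)\<^sup>2)" if "b \<in> B" for b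
      using gaussian_bilinear_moments(1)[OF M X, of b a] B(3)[OF that] by simp
    then have "has_bochner_integral M (\<lambda>\<omega>. \<Sum>b\<in>B. (b \<bullet> (X \<omega> *v a))\<^sup>2) (\<Sum>b\<in>B. (norm a)\<^sup>2)"
      by (rule has_bochner_integral_sum)
    then show ?thesis by (simp add: q_def)
  qed
  have "has_bochner_integral M (\<lambda>\<omega>. (b \<bullet> (X \<omega> *v a))\<^sup>2 * (b' \<bullet> (X \<omega> *v a))\<^sup>2)
      ((if b = b' then 3 else 1) * (norm a)^4)" if "b \<in> B" "b' \<in> B" for b b'
  proof (cases "b = b'")
    case True
    have "(u\<^sup>2 * u\<^sup>2 :: real) = u^4" "(u\<^sup>2)\<^sup>2 = u^4" for u :: real
      by (simp_all add: power4_eq_xxxx power2_eq_square)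
    then show ?thesis
      using gaussian_bilinear_moments(2)[OF M X, of b a] B(3)[OF that(1)] True by simp
  next
    case False
    then have "b \<bullet> b' = 0" using B(2) that by (auto simp: pairwise_def orthogonal_def)
    then show ?thesis
      using gaussian_bilinear_square_product[OF M X] B(3) that False by simp
  qed
  then have "has_bochner_integral M (\<lambda>\<omega>. \<Sum>b\<in>B. \<Sum>b'\<in>B. (b \<bullet> (X \<omega> *v a))\<^sup>2 * (b' \<bullet> (X \<omega> *v a))\<^sup>2)
      (\<Sum>b\<in>B. \<Sum>b'\<in>B. (if b = b' then 3 else 1) * (norm a)^4)"
    by (intro has_bochner_integral_sum)
  moreover have "(\<Sum>b\<in>B. \<Sum>b'\<in>B. (if b = b' then 3 else 1) * (norm a)^4)
      = card B * (card B + 2) * (norm a)^4"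
  proof -
    have "(\<Sum>b'\<in>B. (if b = b' then 3 else 1 :: real)) = card B + 2" if "b \<in> B" for b
    proof -
      have "(\<Sum>b'\<in>B. (if b = b' then 3 else 1 :: real)) = (\<Sum>b'\<in>B. 1 + (if b = b' then 2 else 0))"
        by (intro sum.cong) auto
      then show ?thesis using B(1) that by (simp only: sum.distrib) simp
    qed
    then show ?thesis
      unfolding sum_distrib_right[symmetric] by (simp add: algebra_simps)
  qed
  ultimately show "has_bochner_integral M (\<lambda>\<omega>. (q \<omega>)\<^sup>2) (card B * (card B + 2) * (norm a)^4)"
    unfolding q_def power2_eq_square[of "sum _ _"] sum_product by simp
qed

text \<open>The left-hand side is the quadratic polynomial in \<open>s\<^sup>2\<close> that is tangent to \<open>s\<close> at \<open>s = c\<close> and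
  vanishes at \<open>s = 0\<close>. It turns the second and fourth moments of a norm into a lower bound for its
  mean.\<close>

lemma ge_even_quartic:
  fixes c s :: real
  assumes "c > 0" "s \<ge> 0"
  shows "3 * s\<^sup>2 / (2 * c) - (s\<^sup>2)\<^sup>2 / (2 * c^3) \<le> s"
proof -
  have "0 \<le> s * (s - c)\<^sup>2 * (s + 2 * c)" using assms by simp
  also have "\<dots> = 2 * c^3 * (s - (3 * s\<^sup>2 / (2 * c) - (s\<^sup>2)\<^sup>2 / (2 * c^3)))"
    using assms by (simp add: field_simps power2_eq_square power3_eq_cube)
  finally show ?thesis using assms by (simp add: zero_le_mult_iff)
qed

text \<open>Passing to \<open>ennreal\<close> replaces \<open>f\<close> by its positive part. The
  polynomial lower bound for the norm takes negative values, so this inequality is what carries its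
  mean over.\<close>

lemma ennreal_integral_le_nn_integral:
  fixes f :: "'a \<Rightarrow> real"
  assumes "integrable M f"
  shows "ennreal (\<integral>\<omega>. f \<omega> \<partial>M) \<le> (\<integral>\<^sup>+\<omega>. ennreal (f \<omega>) \<partial>M)"
proof -
  have "ennreal (\<integral>\<omega>. f \<omega> \<partial>M) \<le> ennreal (\<integral>\<omega>. max 0 (f \<omega>) \<partial>M)"
    using assms by (intro ennreal_leI integral_mono) auto
  also have "\<dots> = (\<integral>\<^sup>+\<omega>. ennreal (max 0 (f \<omega>)) \<partial>M)"
    using assms by (intro nn_integral_eq_integral[symmetric]) auto
  also have "\<dots> = (\<integral>\<^sup>+\<omega>. ennreal (f \<omega>) \<partial>M)"
    by (intro nn_integral_cong) (simp add: max_def ennreal_neg)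
  finally show ?thesis .
qed

text \<open>Orthonormal directions that annihilate the range of \<open>G\<close> give a lower bound
  \<open>Q\<close> for the distance that is the same for all \<open>y\<close>. It can therefore be
  put under the infimum, and its mean follows from the second and fourth moments.\<close>

lemma gaussian_distance_lower_bound:
  fixes X :: "'a \<Rightarrow> real^'k^'m" and G :: "real^'p^'m"
  assumes M: "prob_space M" and X: "std_gaussian_matrix M X" and d: "d + CARD('p) \<le> CARD('m)" "d \<ge> 2"
  shows "ennreal (sqrt (real d - 2)) * ennreal (norm a)
    \<le> (\<integral>\<^sup>+\<omega>. (INF y\<in>E. ennreal (norm (X \<omega> *v a - G *v y))) \<partial>M)"
proof (cases "a = 0")
  case False
  obtain B where B: "card B = d" "finite B" "pairwise orthogonal B" "\<And>b. b \<in> B \<Longrightarrow> norm b = 1"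
    "\<And>b y. b \<in> B \<Longrightarrow> b \<bullet> (G *v y) = 0"
    using orthonormal_subset_of_complement[OF d(1), of G] by blast
  define q where "q \<omega> = (\<Sum>b\<in>B. (b \<bullet> (X \<omega> *v a))\<^sup>2)" for \<omega>
  \<comment> \<open>The tangent point \<open>c\<close> is chosen so that \<open>c\<^sup>2\<close> is
    the ratio of the means of \<open>(q \<omega>)\<^sup>2\<close> and \<open>q \<omega>\<close>,
    which maximises the resulting bound.\<close>
  define s where "s = sqrt (real d + 2)"
  define c where "c = s * norm a"
  define Q where "Q \<omega> = 3 * q \<omega> / (2 * c) - (q \<omega>)\<^sup>2 / (2 * c^3)" for \<omega>
  have s: "s > 0" "s\<^sup>2 = real d + 2" by (simp_all add: s_def)
  have c: "c > 0" using False s by (simp add: c_def)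
  note qm = gaussian_projection_moments[OF M X B(2,3,4), of a, folded q_def, unfolded B(1)]
  have q0: "q \<omega> \<ge> 0" for \<omega> by (simp add: q_def sum_nonneg)
  have "Q \<omega> \<le> norm (X \<omega> *v a - G *v y)" for \<omega> y
  proof -
    have "Q \<omega> \<le> sqrt (q \<omega>)"
      using ge_even_quartic[OF c, of "sqrt (q \<omega>)"] q0 by (simp add: Q_def)
    also have "q \<omega> = (\<Sum>b\<in>B. (b \<bullet> (X \<omega> *v a - G *v y))\<^sup>2)"
      using B(5) by (simp add: q_def inner_diff_right)
    also have "sqrt \<dots> \<le> norm (X \<omega> *v a - G *v y)"
      using bessel_inequality[OF B(3,4)] by (intro real_le_lsqrt) auto
    finally show ?thesis .
  qed
  then have le: "(\<integral>\<^sup>+\<omega>. ennreal (Q \<omega>) \<partial>M) \<le> (\<integral>\<^sup>+\<omega>. (INF y\<in>E. ennreal (norm (X \<omega> *v a - G *v y))) \<partial>M)"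
    by (intro nn_integral_mono INF_greatest ennreal_leI)
  have Q: "has_bochner_integral M Q
      (3 * (d * (norm a)\<^sup>2) / (2 * c) - d * (d + 2) * (norm a)^4 / (2 * c^3))"
    using qm unfolding Q_def[abs_def] by (simp add: has_bochner_integral_iff)
  have "ennreal (sqrt (real d - 2)) * ennreal (norm a) \<le> ennreal (\<integral>\<omega>. Q \<omega> \<partial>M)"
  proof -
    have "(\<integral>\<omega>. Q \<omega> \<partial>M) = norm a * (3 * d / (2 * s) - d * s\<^sup>2 / (2 * s^3))"
    proof -
      have "3 * (d * n\<^sup>2) / (2 * (s * n)) - D * n^4 / (2 * (s * n)^3)
          = n * (3 * d / (2 * s) - D / (2 * s^3))" if "n > 0" for n D :: real
        using that s(1) by (simp add: field_simps power2_eq_square power3_eq_cube power4_eq_xxxx)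
      from this[of "norm a" "d * s\<^sup>2"] show ?thesis
        using has_bochner_integral_integral_eq[OF Q] False by (simp add: c_def s(2) algebra_simps)
    qed
    also have "3 * d / (2 * s) - d * s\<^sup>2 / (2 * s^3) = d / s"
      using s(1) by (simp add: field_simps power2_eq_square power3_eq_cube)
    finally have "(\<integral>\<omega>. Q \<omega> \<partial>M) = norm a * (d / s)" .
    moreover have "sqrt (real d - 2) \<le> d / s"
    proof (rule real_le_lsqrt)
      \<comment> \<open>This is \<open>(d - 2) * (d + 2) \<le> d\<^sup>2\<close>.\<close>
      have "(real d - 2) * s\<^sup>2 \<le> (real d)\<^sup>2"
        unfolding s(2) by (simp add: power2_eq_square algebra_simps)
      then show "real d - 2 \<le> (d / s)\<^sup>2"
        using s(1) by (simp add: power_divide pos_le_divide_eq)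
    qed (use d s in auto)
    ultimately have "sqrt (real d - 2) * norm a \<le> (\<integral>\<omega>. Q \<omega> \<partial>M)"
      by (simp only: mult.commute[of _ "norm a"]) (intro mult_left_mono norm_ge_zero)
    then show ?thesis
      using d(2) by (simp only: ennreal_mult[symmetric] real_sqrt_ge_zero norm_ge_zero) (simp add: ennreal_leI ennreal_mult[symmetric])
  qed
  also have "ennreal (\<integral>\<omega>. Q \<omega> \<partial>M) \<le> (\<integral>\<^sup>+\<omega>. ennreal (Q \<omega>) \<partial>M)"
    by (rule ennreal_integral_le_nn_integral[OF integrable.intros[OF Q]])
  also note le
  finally show ?thesis .
next
  case True
  then show ?thesis by (simp only: norm_zero ennreal_0 mult_zero_right zero_le)
qed

section \<open>Projected block matrices\<close>

text \<open>The projection moves \<open>v\<close> by an element of the range of \<open>G\<close>.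
  This lets the lower bound work with distances to that range instead of the chosen orthonormal
  basis.\<close>

lemma residual_mat_1:
  fixes G :: "real^'p^'m"
  obtains y where "residual (mat 1) G *v v = v - G *v y"
proof -
  let ?R = "range (\<lambda>x. (mat 1 ** G) *v x)"
  have "subspace ?R"
    by (rule linear_subspace_image[OF matrix_vector_mul_linear subspace_UNIV])
  from someI_ex[OF orthonormal_basis_exists[OF this]]
  have B: "orthonormal_basis (SOME B. orthonormal_basis B ?R) ?R" (is "orthonormal_basis ?B _") .
  obtain y where "QQ_star ?B *v v = G *v y"
    using QQ_star_projects(1)[OF B, of v] by auto
  then show thesis
    by (intro that[of y]) (simp add: residual_def matrix_vector_mult_diff_rdistrib)
qed

text \<open>Pythagoras for the decomposition of \<open>v\<close> into its projection
  \<open>q\<close> and the orthogonal rest.\<close>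

lemma norm_residual_mat_1_le: "norm (residual (mat 1) G *v v) \<le> norm v"
proof -
  let ?R = "range (\<lambda>x. (mat 1 ** G) *v x)"
  have "subspace ?R"
    by (rule linear_subspace_image[OF matrix_vector_mul_linear subspace_UNIV])
  from someI_ex[OF orthonormal_basis_exists[OF this]]
  have B: "orthonormal_basis (SOME B. orthonormal_basis B ?R) ?R" (is "orthonormal_basis ?B _") .
  define q where "q = QQ_star ?B *v v"
  have "(v - q) \<bullet> q = 0"
    unfolding q_def by (intro QQ_star_projects(2)[OF B] QQ_star_projects(1)[OF B])
  then have "(norm v)\<^sup>2 = (norm (v - q))\<^sup>2 + (norm q)\<^sup>2"
    by (simp add: power2_norm_eq_inner algebra_simps inner_commute)
  then have "(norm (v - q))\<^sup>2 \<le> (norm v)\<^sup>2" by simp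
  then have "norm (v - q) \<le> norm v" by (rule power2_le_imp_le) simp
  then show ?thesis by (simp add: residual_def matrix_vector_mult_diff_rdistrib q_def)
qed

lemma hcat_mult:
  "hcat A B *v z = A *v (\<chi> a. z $ Inl a) + B *v (\<chi> b. z $ Inr b)"
  by (simp add: vec_eq_iff hcat_def matrix_vector_mult_def sum_UNIV_sum_type)

lemma norm_pair_vec:
  fixes z :: "real^('a::finite + 'b::finite)"
  shows "(norm z)\<^sup>2 = (norm (\<chi> a. z $ Inl a))\<^sup>2 + (norm (\<chi> b. z $ Inr b))\<^sup>2"
  by (simp add: power2_norm_eq_inner inner_vec_def sum_UNIV_sum_type)

lemma spectral_norm_residual_hcat_le:
  fixes G :: "real^'p^'m" and A :: "real^'l^'m" and R :: "real^'k^'l"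
  shows "spectral_norm (residual (mat 1) G ** hcat (A ** R) (mat 1)) \<le> 1 + spectral_norm A * spectral_norm R"
proof (rule spectral_norm_le)
  fix z :: "real^('k + 'm)"
  define x y where "x = (\<chi> a. z $ Inl a)" and "y = (\<chi> b. z $ Inr b)"
  have "norm x \<le> norm z" "norm y \<le> norm z"
    using norm_pair_vec[of z] by (simp_all add: x_def y_def power2_le_imp_le[OF _ norm_ge_zero])
  have "norm ((residual (mat 1) G ** hcat (A ** R) (mat 1)) *v z) \<le> norm (hcat (A ** R) (mat 1) *v z)"
    by (simp only: matrix_vector_mul_assoc[symmetric] norm_residual_mat_1_le)
  also have "\<dots> \<le> norm (A *v (R *v x)) + norm y"
    unfolding hcat_mult x_def[symmetric] y_def[symmetric]
    by (simp add: norm_triangle_ineq flip: matrix_vector_mul_assoc)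
  also have "norm (A *v (R *v x)) \<le> spectral_norm A * (spectral_norm R * norm x)"
    by (rule order_trans[OF spectral_norm_bound mult_left_mono[OF spectral_norm_bound spectral_norm_nonneg]])
  also have "\<dots> \<le> spectral_norm A * (spectral_norm R * norm z)"
    using \<open>norm x \<le> norm z\<close> by (intro mult_left_mono spectral_norm_nonneg)
  finally show "norm ((residual (mat 1) G ** hcat (A ** R) (mat 1)) *v z)
      \<le> (1 + spectral_norm A * spectral_norm R) * norm z"
    using \<open>norm y \<le> norm z\<close> by (simp add: algebra_simps)
qed

text \<open>The block vector with \<open>u\<close> on top and zero below has norm one and hides the
  identity block.\<close>

lemma spectral_norm_residual_hcat_ge:
  fixes G :: "real^'p^'m" and A :: "real^'k^'m"
  assumes u: "norm u = 1"
  obtains y where "norm (A *v u - G *v y) \<le> spectral_norm (residual (mat 1) G ** hcat A (mat 1))"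
proof -
  define z :: "real^('k + 'm)" where "z = (\<chi> j. case_sum (\<lambda>a. u $ a) (\<lambda>b. 0) j)"
  have z: "(\<chi> a. z $ Inl a) = u" "(\<chi> b. z $ Inr b) = 0" by (simp_all add: z_def vec_eq_iff)
  have "(norm z)\<^sup>2 = 1" unfolding norm_pair_vec z using u by simp
  then have nz: "norm z = 1" by (simp add: abs_square_eq_1)
  obtain y where y: "residual (mat 1) G *v (A *v u) = A *v u - G *v y"
    by (rule residual_mat_1)
  have "(residual (mat 1) G ** hcat A (mat 1)) *v z = residual (mat 1) G *v (A *v u)"
    by (simp add: hcat_mult z flip: matrix_vector_mul_assoc)
  then show thesis
    using spectral_norm_bound[of "residual (mat 1) G ** hcat A (mat 1)" z] y nz
    by (intro that[of y]) simp
qed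

section \<open>Measurability of the spectral norm and integration over independent variables\<close>

lemma ennreal_spectral_norm_eq_SUP:
  fixes A :: "real^'s^'r"
  assumes D: "D \<subseteq> sphere 0 1" "sphere 0 1 \<subseteq> closure D"
  shows "ennreal (spectral_norm A) = (SUP u\<in>D. ennreal (norm (A *v u)))"
proof (rule antisym)
  show "(SUP u\<in>D. ennreal (norm (A *v u))) \<le> ennreal (spectral_norm A)"
  proof (intro SUP_least ennreal_leI)
    fix u assume "u \<in> D"
    then have "norm u = 1" using D(1) by auto
    then show "norm (A *v u) \<le> spectral_norm A" using spectral_norm_bound[of A u] by simp
  qed
  show "ennreal (spectral_norm A) \<le> (SUP u\<in>D. ennreal (norm (A *v u)))"
  proof (cases "SUP u\<in>D. ennreal (norm (A *v u))")
    case (real y)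
    have DA: "norm (A *v u) \<le> y" if "u \<in> D" for u
    proof -
      have "ennreal (norm (A *v u)) \<le> ennreal y"
        unfolding real(2)[symmetric] using that by (rule SUP_upper)
      then show ?thesis using real(1) by (simp add: ennreal_le_iff)
    qed
    have "v \<bullet> (A *v u) \<le> y" if "norm u = 1" "norm v = 1" for u v
    proof -
      have "v \<bullet> (A *v w) \<le> y" if "w \<in> D" for w
        using norm_cauchy_schwarz[of v "A *v w"] DA[OF that] \<open>norm v = 1\<close> by simp
      then have "closure D \<subseteq> {u. (v v* A) \<bullet> u \<le> y}"
        by (intro closure_minimal closed_halfspace_le) (auto simp: dot_lmul_matrix)
      then show ?thesis using D(2) that(1) by (auto simp: dot_lmul_matrix)
    qed
    then have "spectral_norm A \<le> y" by (rule spectral_norm_le_bilinear)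
    then show ?thesis unfolding real(2) by (rule ennreal_leI)
  next
    case top
    show ?thesis unfolding top by (rule top_greatest)
  qed
qed

lemma countable_dense_sphere:
  obtains D where "countable D" "D \<subseteq> sphere 0 1" "sphere (0 :: 'a::euclidean_space) 1 \<subseteq> closure D"
  using separable[of "sphere (0 :: 'a) 1"] by metis

lemma borel_measurable_matrix_entry [measurable]:
  assumes "f \<in> borel_measurable M"
  shows "(\<lambda>x. (f x :: real^'s^'r) $ i $ j) \<in> borel_measurable M"
  by (rule measurable_compose[OF assms borel_measurable_continuous_onI]) (intro continuous_intros)

lemma borel_measurable_norm_entries:
  fixes f :: "'a \<Rightarrow> real^'r"
  assumes "\<And>i. (\<lambda>x. f x $ i) \<in> borel_measurable M"
  shows "(\<lambda>x. norm (f x)) \<in> borel_measurable M"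
  unfolding norm_vec_def L2_set_def using assms by measurable

text \<open>A supremum over a countable dense set of directions is measurable. Asking for measurable
  entries only suits \<open>diag_inv\<close>, whose measurability is shown entry by entry.\<close>

lemma borel_measurable_ennreal_spectral_norm:
  fixes f :: "'a \<Rightarrow> real^'s^'r"
  assumes "\<And>i j. (\<lambda>x. f x $ i $ j) \<in> borel_measurable M"
  shows "(\<lambda>x. ennreal (spectral_norm (f x))) \<in> borel_measurable M"
proof -
  obtain D :: "(real^'s) set" where D: "countable D" "D \<subseteq> sphere 0 1" "sphere 0 1 \<subseteq> closure D"
    by (rule countable_dense_sphere)
  have "(\<lambda>x. norm (f x *v u)) \<in> borel_measurable M" for u
    using assms by (intro borel_measurable_norm_entries) (simp add: matrix_vector_mult_def)
  then show ?thesis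
    unfolding ennreal_spectral_norm_eq_SUP[OF D(2,3)]
    by (intro borel_measurable_SUP D(1)) simp
qed

text \<open>The library constant \<open>indep_var\<close> needs a common value type, so independence is expressed
  through the generated families of events.\<close>

lemma (in prob_space) indep_set_nn_integral:
  assumes U: "U \<in> measurable M S" and V: "V \<in> measurable M T"
    and ind: "indep_set {U -` A \<inter> space M | A. A \<in> sets S} {V -` B \<inter> space M | B. B \<in> sets T}"
    and f: "f \<in> borel_measurable (S \<Otimes>\<^sub>M T)"
  shows "(\<integral>\<^sup>+\<omega>. f (U \<omega>, V \<omega>) \<partial>M) = (\<integral>\<^sup>+\<omega>'. (\<integral>\<^sup>+\<omega>. f (U \<omega>, V \<omega>') \<partial>M) \<partial>M)"
proof -
  interpret U: prob_space "distr M S U" by (rule prob_space_distr[OF U])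
  interpret V: prob_space "distr M T V" by (rule prob_space_distr[OF V])
  interpret UV: pair_sigma_finite "distr M S U" "distr M T V" ..
  \<comment> \<open>Independence says that the joint law is a product measure; Tonelli's theorem
    then gives the iterated integral.\<close>
  have eq: "distr M S U \<Otimes>\<^sub>M distr M T V = distr M (S \<Otimes>\<^sub>M T) (\<lambda>x. (U x, V x))"
  proof (rule pair_measure_eqI)
    fix A B assume "A \<in> sets (distr M S U)" "B \<in> sets (distr M T V)"
    then have AB: "A \<in> sets S" "B \<in> sets T" by auto
    have "prob ((U -` A \<inter> space M) \<inter> (V -` B \<inter> space M)) = prob (U -` A \<inter> space M) * prob (V -` B \<inter> space M)"
      using AB by (intro indep_setD[OF ind]) auto
    moreover have "(\<lambda>x. (U x, V x)) -` (A \<times> B) \<inter> space M = (U -` A \<inter> space M) \<inter> (V -` B \<inter> space M)"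
      by auto
    ultimately show "emeasure (distr M S U) A * emeasure (distr M T V) B
        = emeasure (distr M (S \<Otimes>\<^sub>M T) (\<lambda>x. (U x, V x))) (A \<times> B)"
      using AB U V by (simp add: emeasure_distr emeasure_eq_measure ennreal_mult)
  qed (simp_all add: U.sigma_finite_measure_axioms V.sigma_finite_measure_axioms cong: sets_pair_measure_cong)
  have f': "f \<in> borel_measurable (distr M S U \<Otimes>\<^sub>M distr M T V)"
    using f by (simp cong: measurable_cong_sets)
  have fs: "(\<lambda>x. f (x, y)) \<in> borel_measurable S" if "y \<in> space T" for y
    using measurable_compose[OF measurable_Pair2'[OF that] f] .
  have "(\<integral>\<^sup>+\<omega>. f (U \<omega>, V \<omega>) \<partial>M) = (\<integral>\<^sup>+z. f z \<partial>(distr M S U \<Otimes>\<^sub>M distr M T V))"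
    unfolding eq using U V f by (subst nn_integral_distr) auto
  also have "\<dots> = (\<integral>\<^sup>+y. \<integral>\<^sup>+x. f (x, y) \<partial>distr M S U \<partial>distr M T V)"
    by (rule UV.nn_integral_snd[symmetric]) (use f' in simp)
  also have "\<dots> = (\<integral>\<^sup>+\<omega>'. (\<integral>\<^sup>+x. f (x, V \<omega>') \<partial>distr M S U) \<partial>M)"
    using V U.borel_measurable_nn_integral_fst[of "\<lambda>(y, x). f (x, y)" T] f
    by (subst nn_integral_distr) (auto simp: measurable_split_conv)
  also have "\<dots> = (\<integral>\<^sup>+\<omega>'. (\<integral>\<^sup>+\<omega>. f (U \<omega>, V \<omega>') \<partial>M) \<partial>M)"
    using U V fs by (intro nn_integral_cong nn_integral_distr) (auto dest: measurable_space)
  finally show ?thesis .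
qed

text \<open>Events of \<open>X\<close> are independent of rectangles in \<open>Y\<close> and
  \<open>Z\<close>. Both families are stable under intersection, so independence extends to the
  generated sigma-algebras, and rectangles generate the one of the pair.\<close>

lemma indep_vars3_imp_indep_set:
  fixes X :: "'a \<Rightarrow> 'b::topological_space" and Y :: "'a \<Rightarrow> 'c::topological_space"
    and Z :: "'a \<Rightarrow> 'd::topological_space"
  assumes M: "prob_space M" and ind: "indep_vars3 M X Y Z"
  shows "prob_space.indep_set M {X -` A \<inter> space M | A. A \<in> sets borel}
    {(\<lambda>\<omega>. (Y \<omega>, Z \<omega>)) -` A \<inter> space M | A. A \<in> sets (borel \<Otimes>\<^sub>M borel)}"
proof -
  interpret prob_space M by fact
  have m: "X \<in> borel_measurable M" "Y \<in> borel_measurable M" "Z \<in> borel_measurable M"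
    using ind by (auto simp: indep_vars3_def)
  let ?E = "\<lambda>i::nat. [{X -` A \<inter> space M | A. A \<in> sets borel}, {Y -` A \<inter> space M | A. A \<in> sets borel},
             {Z -` A \<inter> space M | A. A \<in> sets borel}] ! i"
  have E: "indep_sets ?E {0, 1, 2}" using ind by (simp add: indep_vars3_def)
  let ?A = "{X -` A \<inter> space M | A. A \<in> sets borel}"
  let ?B = "{(Y -` B \<inter> space M) \<inter> (Z -` C \<inter> space M) | B C. B \<in> sets borel \<and> C \<in> sets borel}"
  have "indep_set ?A ?B"
  proof (rule indep_setI)
    show "?A \<subseteq> events" "?B \<subseteq> events" using m by (auto intro: measurable_sets)
    fix a b assume "a \<in> ?A" "b \<in> ?B"
    then obtain A B C where abc: "a = X -` A \<inter> space M" "b = (Y -` B \<inter> space M) \<inter> (Z -` C \<inter> space M)"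
      "A \<in> sets borel" "B \<in> sets borel" "C \<in> sets borel" by auto
    let ?F = "\<lambda>i::nat. [X -` A \<inter> space M, Y -` B \<inter> space M, Z -` C \<inter> space M] ! i"
    have "prob (\<Inter>j\<in>{0,1,2}. ?F j) = (\<Prod>j\<in>{0,1,2}. prob (?F j))"
      using abc by (intro indep_setsD[OF E]) auto
    \<comment> \<open>The product rule for the last two events alone turns the triple product into
      \<open>prob a * prob b\<close>.\<close>
    moreover have "prob (\<Inter>j\<in>{1,2}. ?F j) = (\<Prod>j\<in>{1,2}. prob (?F j))"
      using abc by (intro indep_setsD[OF E]) auto
    ultimately show "prob (a \<inter> b) = prob a * prob b"
      by (simp add: abc numeral_2_eq_2)
  qed
  then have "indep_set (sigma_sets (space M) ?A) (sigma_sets (space M) ?B)"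
  proof (rule indep_set_sigma_sets)
    show "Int_stable ?A"
    proof (rule Int_stableI)
      fix a b assume "a \<in> ?A" "b \<in> ?A"
      then obtain A B where "a \<inter> b = X -` (A \<inter> B) \<inter> space M" "A \<inter> B \<in> sets borel" by auto
      then show "a \<inter> b \<in> ?A" by blast
    qed
    show "Int_stable ?B"
    proof (rule Int_stableI)
      fix a b assume "a \<in> ?B" "b \<in> ?B"
      then obtain B C B' C' where
        "a = (Y -` B \<inter> space M) \<inter> (Z -` C \<inter> space M)" "B \<in> sets borel" "C \<in> sets borel"
        "b = (Y -` B' \<inter> space M) \<inter> (Z -` C' \<inter> space M)" "B' \<in> sets borel" "C' \<in> sets borel" by auto
      then have "a \<inter> b = (Y -` (B \<inter> B') \<inter> space M) \<inter> (Z -` (C \<inter> C') \<inter> space M)"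
        "B \<inter> B' \<in> sets borel" "C \<inter> C' \<in> sets borel" by auto
      then show "a \<inter> b \<in> ?B" by blast
    qed
  qed
  moreover have "{(\<lambda>\<omega>. (Y \<omega>, Z \<omega>)) -` A \<inter> space M | A. A \<in> sets (borel \<Otimes>\<^sub>M borel :: ('c \<times> 'd) measure)}
      = sigma_sets (space M) ?B"
  proof -
    have "{(\<lambda>\<omega>. (Y \<omega>, Z \<omega>)) -` A \<inter> space M | A. A \<in> sets (borel \<Otimes>\<^sub>M borel :: ('c \<times> 'd) measure)}
        = sigma_sets (space M) {(\<lambda>\<omega>. (Y \<omega>, Z \<omega>)) -` A \<inter> space M | A.
            A \<in> {B \<times> C | B C. B \<in> sets borel \<and> C \<in> sets borel}}"
      unfolding sets_pair_measure by (subst sigma_sets_vimage_commute) auto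
    also have "{(\<lambda>\<omega>. (Y \<omega>, Z \<omega>)) -` A \<inter> space M | A. A \<in> {B \<times> C | B C. B \<in> sets borel \<and> C \<in> sets borel}} = ?B"
      (is "?L = _")
    proof (intro set_eqI iffI)
      have eq: "(\<lambda>\<omega>. (Y \<omega>, Z \<omega>)) -` (B \<times> C) \<inter> space M = (Y -` B \<inter> space M) \<inter> (Z -` C \<inter> space M)" for B C
        by auto
      fix w
      show "w \<in> ?B" if "w \<in> ?L"
      proof -
        from that obtain B C where "B \<in> sets borel" "C \<in> sets borel"
          "w = (\<lambda>\<omega>. (Y \<omega>, Z \<omega>)) -` (B \<times> C) \<inter> space M" by blast
        then show ?thesis unfolding eq by blast
      qed
      show "w \<in> ?L" if "w \<in> ?B"
      proof -
        from that obtain B C where "B \<in> sets borel" "C \<in> sets borel"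
          "w = (Y -` B \<inter> space M) \<inter> (Z -` C \<inter> space M)" by blast
        then show ?thesis unfolding eq[symmetric] by blast
      qed
    qed
    finally show ?thesis .
  qed
  moreover have "?A \<subseteq> sigma_sets (space M) ?A" by blast
  ultimately show ?thesis
    unfolding indep_set_def by (elim indep_sets_mono_sets) (auto split: bool.split)
qed

section \<open>The two bounds\<close>

text \<open>On singular matrices \<open>matrix_inv\<close> is an unspecified matrix, which is the same for all of
  them; hence \<open>matrix_inv\<close> agrees with a Borel function on the diagonal matrices.\<close>

definition diag_inv :: "real^'k^'k \<Rightarrow> real^'k^'k" where
  "diag_inv A = (if \<forall>j. A $ j $ j \<noteq> 0 then \<chi> i j. if i = j then 1 / A $ i $ i else 0 else matrix_inv 0)"

lemma matrix_inv_diagonal: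
  fixes A :: "real^'k^'k"
  assumes A: "is_diagonal A"
  shows "matrix_inv A = diag_inv A"
proof (cases "\<forall>j. A $ j $ j \<noteq> 0")
  case True
  define B :: "real^'k^'k" where "B = (\<chi> i j. if i = j then 1 / A $ i $ i else 0)"
  have B: "A ** B = mat 1" "B ** A = mat 1"
    using A True by (auto simp: B_def matrix_matrix_mult_def mat_def vec_eq_iff is_diagonal_def
        if_distrib[of "\<lambda>x. x * _"] if_distrib[of "\<lambda>x. _ * x"] cong: if_cong)
  have inv: "A ** matrix_inv A = mat 1 \<and> matrix_inv A ** A = mat 1"
    unfolding matrix_inv_def by (rule someI[of _ B]) (intro conjI B)
  have "matrix_inv A = (B ** A) ** matrix_inv A" by (simp add: B)
  also have "\<dots> = B ** (A ** matrix_inv A)" by (simp only: matrix_mul_assoc)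
  also have "\<dots> = B" by (simp add: inv)
  finally show ?thesis using True by (simp add: diag_inv_def B_def)
next
  case False
  then obtain j where j: "A $ j $ j = 0" by blast
  have zero: "C ** B \<noteq> mat 1" if "\<And>l. C $ j $ l = 0" for B C :: "real^'k^'k"
  proof
    assume "C ** B = mat 1"
    then have "(C ** B) $ j $ j = (mat 1 :: real^'k^'k) $ j $ j" by simp
    then show False using that by (simp add: matrix_matrix_mult_def mat_def)
  qed
  have "A $ j $ l = 0" for l
    using A j by (cases "l = j") (auto simp: is_diagonal_def)
  \<comment> \<open>A zero row excludes any inverse. The defining condition is then false for every
    candidate, both for \<open>A\<close> and for the zero matrix, so the choice operator returns the
    same value.\<close>
  then have "matrix_inv A = matrix_inv 0"
    unfolding matrix_inv_def using zero[of A] zero[of 0] by simp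
  then show ?thesis by (simp only: diag_inv_def if_not_P[OF False])
qed

lemma borel_measurable_diag_inv [measurable]:
  fixes f :: "'a \<Rightarrow> real^'k^'k"
  assumes [measurable]: "f \<in> borel_measurable M"
  shows "(\<lambda>x. diag_inv (f x) $ i $ j) \<in> borel_measurable M"
proof -
  have "(\<lambda>x. diag_inv (f x) $ i $ j) = (\<lambda>x. if \<forall>l. f x $ l $ l \<noteq> 0
      then if i = j then 1 / f x $ i $ i else 0 else matrix_inv (0 :: real^'k^'k) $ i $ j)"
    by (auto simp: diag_inv_def)
  then show ?thesis by simp
qed

text \<open>By continuity some point of \<open>E\<close> comes within any \<open>e > 0\<close> of
  the value at \<open>y0\<close>. A countable infimum, which is measurable, can thus stand in for
  the distance to the range of \<open>G\<close>.\<close>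

lemma INF_dense_norm_le:
  fixes G :: "real^'p^'m"
  assumes E: "closure E = UNIV"
  shows "(INF y\<in>E. ennreal (norm (v - G *v y))) \<le> ennreal (norm (v - G *v y0))"
proof (rule ennreal_le_epsilon)
  fix e :: real assume "e > 0"
  let ?U = "{y. norm (v - G *v y) < norm (v - G *v y0) + e}"
  have "open ?U"
    by (intro open_Collect_less continuous_intros matrix_vector_mult_linear_continuous_on)
  moreover have "y0 \<in> ?U" using \<open>e > 0\<close> by simp
  ultimately have "?U \<inter> E \<noteq> {}"
    using open_Int_closure_eq_empty[of ?U E] E by blast
  then obtain y where y: "y \<in> E" "norm (v - G *v y) < norm (v - G *v y0) + e"
    by auto
  have "(INF y\<in>E. ennreal (norm (v - G *v y))) \<le> ennreal (norm (v - G *v y0) + e)"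
    using y by (intro INF_lower2[of y] ennreal_leI) auto
  then show "(INF y\<in>E. ennreal (norm (v - G *v y))) \<le> ennreal (norm (v - G *v y0)) + ennreal e"
    using \<open>e > 0\<close> by (simp add: ennreal_plus)
qed

lemma nn_integral_spectral_norm_prod:
  fixes X1 :: "'a \<Rightarrow> real^'k^'m" and X2 :: "'a \<Rightarrow> real^'p^'m" and S :: "'a \<Rightarrow> real^'k^'k"
  assumes M: "prob_space M" and ind: "indep_vars3 M X1 X2 S"
  shows "(\<integral>\<^sup>+\<omega>. ennreal (spectral_norm (X1 \<omega>)) * ennreal (spectral_norm (diag_inv (S \<omega>))) \<partial>M)
    = (\<integral>\<^sup>+\<omega>. ennreal (spectral_norm (X1 \<omega>)) \<partial>M) * (\<integral>\<^sup>+\<omega>. ennreal (spectral_norm (diag_inv (S \<omega>))) \<partial>M)"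
proof -
  interpret prob_space M by fact
  have [measurable]: "X1 \<in> borel_measurable M" "X2 \<in> borel_measurable M" "S \<in> borel_measurable M"
    using ind by (auto simp: indep_vars3_def)
  have X: "(\<lambda>x. ennreal (spectral_norm (f x))) \<in> borel_measurable N"
    if [measurable]: "f \<in> borel_measurable N" for f :: "'z \<Rightarrow> real^'k^'m" and N
    by (rule borel_measurable_ennreal_spectral_norm) measurable
  have D: "(\<lambda>x. ennreal (spectral_norm (diag_inv (f x)))) \<in> borel_measurable N"
    if [measurable]: "f \<in> borel_measurable N" for f :: "'z \<Rightarrow> real^'k^'k" and N
    by (rule borel_measurable_ennreal_spectral_norm) measurable
  have "(\<lambda>z :: (real^'k^'m) \<times> (real^'p^'m) \<times> (real^'k^'k).
      ennreal (spectral_norm (fst z)) * ennreal (spectral_norm (diag_inv (snd (snd z)))))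
    \<in> borel_measurable (borel \<Otimes>\<^sub>M borel \<Otimes>\<^sub>M borel)"
    by (intro borel_measurable_times_ennreal X D) measurable
  from indep_set_nn_integral[OF _ _ indep_vars3_imp_indep_set[OF M ind] this]
  show ?thesis
    using X[of X1 M] D[of S M] by (simp add: nn_integral_multc nn_integral_cmult)
qed

text \<open>Since \<open>X1\<close> is independent of the pair formed by \<open>X2\<close> and
  \<open>S\<close>, that pair can be frozen. For each direction \<open>u\<close> the Gaussian
  distance bound applies to \<open>diag_inv s *v u\<close>, and the supremum over \<open>u\<close>
  recovers the norm of the inverse.\<close>

lemma expected_spectral_norm_lower_bound:
  fixes X1 :: "'a \<Rightarrow> real^'k^'m" and X2 :: "'a \<Rightarrow> real^'p^'m" and S :: "'a \<Rightarrow> real^'k^'k"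
  assumes M: "prob_space M" and X: "std_gaussian_matrix M X1" and ind: "indep_vars3 M X1 X2 S"
    and d: "d + CARD('p) \<le> CARD('m)" "d \<ge> 2"
  shows "ennreal (sqrt (real d - 2)) * (\<integral>\<^sup>+\<omega>. ennreal (spectral_norm (diag_inv (S \<omega>))) \<partial>M)
    \<le> (\<integral>\<^sup>+\<omega>. ennreal (spectral_norm
        (residual (mat 1) (X2 \<omega>) ** hcat (X1 \<omega> ** diag_inv (S \<omega>)) (mat 1))) \<partial>M)"
proof -
  interpret prob_space M by fact
  have [measurable]: "X1 \<in> borel_measurable M" "X2 \<in> borel_measurable M" "S \<in> borel_measurable M"
    using ind by (auto simp: indep_vars3_def)
  obtain D :: "(real^'k) set" where D: "countable D" "D \<subseteq> sphere 0 1" "sphere 0 1 \<subseteq> closure D"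
    by (rule countable_dense_sphere)
  obtain E :: "(real^'p) set" where E: "countable E" "closure E = UNIV"
    using separable[of "UNIV :: (real^'p) set"] by (metis top.extremum_uniqueI)
  \<comment> \<open>A jointly measurable lower bound for the norm, built from countable suprema and
    infima. It makes the iterated integral available without any measurability of the
    projector.\<close>
  define \<phi> :: "(real^'k^'m) \<times> (real^'p^'m) \<times> (real^'k^'k) \<Rightarrow> ennreal" where
    "\<phi> = (\<lambda>(x, g, s). SUP u\<in>D. INF y\<in>E. ennreal (norm (x *v (diag_inv s *v u) - g *v y)))"
  have \<phi>: "\<phi> \<in> borel_measurable (borel \<Otimes>\<^sub>M borel \<Otimes>\<^sub>M borel)"
    unfolding \<phi>_def case_prod_unfold
  proof (intro borel_measurable_SUP D(1) borel_measurable_INF E(1) measurable_compose[OF _ measurable_ennreal]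
      borel_measurable_norm_entries)
    fix u :: "real^'k" and y :: "real^'p" and i
    show "(\<lambda>z :: (real^'k^'m) \<times> (real^'p^'m) \<times> (real^'k^'k).
        (fst z *v (diag_inv (snd (snd z)) *v u) - fst (snd z) *v y) $ i)
      \<in> borel_measurable (borel \<Otimes>\<^sub>M borel \<Otimes>\<^sub>M borel)"
      by (simp add: matrix_vector_mult_def)
  qed
  have le: "\<phi> (X1 \<omega>, X2 \<omega>, S \<omega>)
      \<le> ennreal (spectral_norm (residual (mat 1) (X2 \<omega>) ** hcat (X1 \<omega> ** diag_inv (S \<omega>)) (mat 1)))" for \<omega>
    unfolding \<phi>_def case_prod_conv
  proof (rule SUP_least)
    fix u assume "u \<in> D"
    then have "norm u = 1" using D(2) by auto
    then obtain y where "norm ((X1 \<omega> ** diag_inv (S \<omega>)) *v u - X2 \<omega> *v y)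
        \<le> spectral_norm (residual (mat 1) (X2 \<omega>) ** hcat (X1 \<omega> ** diag_inv (S \<omega>)) (mat 1))"
      by (rule spectral_norm_residual_hcat_ge)
    then show "(INF y\<in>E. ennreal (norm (X1 \<omega> *v (diag_inv (S \<omega>) *v u) - X2 \<omega> *v y)))
      \<le> ennreal (spectral_norm (residual (mat 1) (X2 \<omega>) ** hcat (X1 \<omega> ** diag_inv (S \<omega>)) (mat 1)))"
      using order_trans[OF INF_dense_norm_le[OF E(2)] ennreal_leI]
      by (simp add: matrix_vector_mul_assoc)
  qed
  have "ennreal (sqrt (real d - 2)) * ennreal (spectral_norm R) \<le> (\<integral>\<^sup>+\<omega>. \<phi> (X1 \<omega>, g, s) \<partial>M)"
    if R: "R = diag_inv s" for R g s
  proof -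
    have "ennreal (sqrt (real d - 2)) * ennreal (spectral_norm R)
        = (SUP u\<in>D. ennreal (sqrt (real d - 2)) * ennreal (norm (R *v u)))"
      unfolding ennreal_spectral_norm_eq_SUP[OF D(2,3)] by (rule SUP_mult_left_ennreal)
    \<comment> \<open>Only the easy direction is needed: the integral of a supremum dominates each
      single integral.\<close>
    also have "\<dots> \<le> (\<integral>\<^sup>+\<omega>. \<phi> (X1 \<omega>, g, s) \<partial>M)"
    proof (rule SUP_least)
      fix u assume u: "u \<in> D"
      have "ennreal (sqrt (real d - 2)) * ennreal (norm (R *v u))
          \<le> (\<integral>\<^sup>+\<omega>. (INF y\<in>E. ennreal (norm (X1 \<omega> *v (R *v u) - g *v y))) \<partial>M)"
        by (rule gaussian_distance_lower_bound[OF M X d])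
      also have "\<dots> \<le> (\<integral>\<^sup>+\<omega>. \<phi> (X1 \<omega>, g, s) \<partial>M)"
        unfolding \<phi>_def R case_prod_conv using u by (intro nn_integral_mono SUP_upper)
      finally show "ennreal (sqrt (real d - 2)) * ennreal (norm (R *v u)) \<le> (\<integral>\<^sup>+\<omega>. \<phi> (X1 \<omega>, g, s) \<partial>M)" .
    qed
    finally show ?thesis .
  qed
  then have "(\<integral>\<^sup>+\<omega>'. ennreal (sqrt (real d - 2)) * ennreal (spectral_norm (diag_inv (S \<omega>'))) \<partial>M)
      \<le> (\<integral>\<^sup>+\<omega>'. (\<integral>\<^sup>+\<omega>. \<phi> (X1 \<omega>, X2 \<omega>', S \<omega>') \<partial>M) \<partial>M)"
    by (intro nn_integral_mono) blast
  also have "\<dots> = (\<integral>\<^sup>+\<omega>. \<phi> (X1 \<omega>, X2 \<omega>, S \<omega>) \<partial>M)"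
    by (rule indep_set_nn_integral[OF _ _ indep_vars3_imp_indep_set[OF M ind] \<phi>, symmetric]) measurable
  also have "\<dots> \<le> (\<integral>\<^sup>+\<omega>. ennreal (spectral_norm
        (residual (mat 1) (X2 \<omega>) ** hcat (X1 \<omega> ** diag_inv (S \<omega>)) (mat 1))) \<partial>M)"
    by (intro nn_integral_mono le)
  also have "(\<integral>\<^sup>+\<omega>'. ennreal (sqrt (real d - 2)) * ennreal (spectral_norm (diag_inv (S \<omega>'))) \<partial>M)
      = ennreal (sqrt (real d - 2)) * (\<integral>\<^sup>+\<omega>'. ennreal (spectral_norm (diag_inv (S \<omega>'))) \<partial>M)"
    by (intro nn_integral_cmult borel_measurable_ennreal_spectral_norm) measurable
  finally show ?thesis .
qed

theorem corollary1p3: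
  fixes M :: "'a measure"
    and n k p :: nat
    and X1 :: "'a \<Rightarrow> real^'k^'m"
    and X2 :: "'a \<Rightarrow> real^'p^'m"
    and Y :: "'a \<Rightarrow> real^'k^('k + 'p)"
    and S :: "'a \<Rightarrow> real^'k^'k"
    and W :: "'a \<Rightarrow> real"
  assumes "prob_space M"
    and "k \<ge> 1" and "p \<ge> 1" and "k + p \<le> n"
    and "CARD('k) = k" and "CARD('p) = p" and "CARD('m) = n - k"
    and "std_gaussian_matrix M X1"
    and "std_gaussian_matrix M X2"
    and "std_gaussian_matrix M Y"
    and "\<And>\<omega>. \<omega> \<in> space M \<Longrightarrow> is_diagonal (S \<omega>)"
    and "\<And>\<omega>. \<omega> \<in> space M \<Longrightarrow> lists_singular_values (\<lambda>j. S \<omega> $ j $ j) (Y \<omega>)"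
    and "indep_vars3 M X1 X2 S"
    and "\<And>\<omega>. \<omega> \<in> space M \<Longrightarrow>
      W \<omega> = spectral_norm (residual (mat 1) (X2 \<omega>) ** hcat (X1 \<omega> ** matrix_inv (S \<omega>)) (mat 1))"
  shows "(k + p + 2 \<le> n \<longrightarrow>
        ennreal (sqrt (real n - real (k + p + 2)))
            * expect_nonneg M (\<lambda>\<omega>. spectral_norm (matrix_inv (S \<omega>)))
          \<le> expect_nonneg M W)
      \<and> expect_nonneg M W
          \<le> 1 + ennreal (sqrt (real (n - k)) + sqrt (real k))
              * expect_nonneg M (\<lambda>\<omega>. spectral_norm (matrix_inv (S \<omega>)))"
proof -
  note M = assms(1) and X = assms(8) and ind = assms(13)
  interpret prob_space M by fact
  have [measurable]: "X1 \<in> borel_measurable M" "S \<in> borel_measurable M"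
    using ind by (auto simp: indep_vars3_def)
  let ?I = "\<integral>\<^sup>+\<omega>. ennreal (spectral_norm (diag_inv (S \<omega>))) \<partial>M"
  \<comment> \<open>Each \<open>S \<omega>\<close> is diagonal, so \<open>diag_inv\<close> can
    replace \<open>matrix_inv\<close>; this makes the integrand measurable.\<close>
  have I: "expect_nonneg M (\<lambda>\<omega>. spectral_norm (matrix_inv (S \<omega>))) = ?I"
    unfolding expect_nonneg_def using assms(11) by (intro nn_integral_cong) (simp add: matrix_inv_diagonal)
  have W: "expect_nonneg M W = (\<integral>\<^sup>+\<omega>. ennreal (spectral_norm
      (residual (mat 1) (X2 \<omega>) ** hcat (X1 \<omega> ** diag_inv (S \<omega>)) (mat 1))) \<partial>M)"
    unfolding expect_nonneg_def using assms(11,14)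
    by (intro nn_integral_cong) (simp add: matrix_inv_diagonal)
  have lower: "ennreal (sqrt (real n - real (k + p + 2))) * ?I \<le> expect_nonneg M W" if "k + p + 2 \<le> n"
  proof -
    \<comment> \<open>The lower bound is applied with \<open>d = n - k - p\<close>. The condition on
      \<open>n\<close> gives \<open>d \<ge> 2\<close> and makes the truncated subtraction
      exact.\<close>
    have eq: "real n - real (k + p + 2) = real (n - k - p) - 2" using that by simp
    show ?thesis
      unfolding W eq using that assms(6,7)
      by (intro expected_spectral_norm_lower_bound[OF M X ind]) auto
  qed
  have "expect_nonneg M W
      \<le> (\<integral>\<^sup>+\<omega>. 1 + ennreal (spectral_norm (X1 \<omega>)) * ennreal (spectral_norm (diag_inv (S \<omega>))) \<partial>M)"
    unfolding W
  proof (rule nn_integral_mono)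
    fix \<omega>
    show "ennreal (spectral_norm (residual (mat 1) (X2 \<omega>) ** hcat (X1 \<omega> ** diag_inv (S \<omega>)) (mat 1)))
        \<le> 1 + ennreal (spectral_norm (X1 \<omega>)) * ennreal (spectral_norm (diag_inv (S \<omega>)))"
      using ennreal_leI[OF spectral_norm_residual_hcat_le[of "X2 \<omega>" "X1 \<omega>" "diag_inv (S \<omega>)"]]
      by (simp add: ennreal_plus ennreal_mult spectral_norm_nonneg)
  qed
  also have "\<dots> = 1 + (\<integral>\<^sup>+\<omega>. ennreal (spectral_norm (X1 \<omega>)) * ennreal (spectral_norm (diag_inv (S \<omega>))) \<partial>M)"
    by (subst nn_integral_add)
      (auto simp: emeasure_space_1 intro!: borel_measurable_times_ennreal borel_measurable_ennreal_spectral_norm)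
  also have "\<dots> = 1 + (\<integral>\<^sup>+\<omega>. ennreal (spectral_norm (X1 \<omega>)) \<partial>M) * ?I"
    by (simp only: nn_integral_spectral_norm_prod[OF M ind])
  also have "\<dots> \<le> 1 + ennreal (sqrt (real (n - k)) + sqrt (real k)) * ?I"
    using chevet[OF M X] assms(5,7) by (intro add_left_mono mult_right_mono) (simp_all add: add.commute)
  finally show ?thesis
    unfolding I using lower by blast
qed

end
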